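(* (a) Define $\pi:k^*\times_{Z_2}k^*/{k^*}^3\to k^*/k^{*3}\times(k^*/k^{*3})/Z_2$ by $\pi([\xi,\alpha])=([\xi],[\alpha])$ and $J_{\mathcal{O}_{[1]}}:\mathcal{O}_{[1]}\to k^*/k^{*3}\times(k^*/k^{*3})/Z_2$ by $J_{\mathcal{O}_{[1]}}=\pi\circ I_{\mathcal{O}_{[1]}}$. (i) Let $P,P'\in\mathcal{O}_{[1]}$. Then $\mathrm{Gl}(2,k)\cdot P=\mathrm{Gl}(2,k)\cdot P'$ if and only if $J_{\mathcal{O}_{[1]}}(P)=J_{\mathcal{O}_{[1]}}(P')$. (ii) The map $J_{\mathcal{O}_{[1]}}$ induces a bijection from $\mathcal{O}_{[1]}/\mathrm{Gl}(2,k)$ onto $k^*/k^{*3}\times(k^*/k^{*3})/Z_2$. (b) Let $\hat k$ be a quadratic extension of $k$. Define $\hat\pi:\mathrm{Im}\,\hat k^*\times_{Z_2}U(\hat k^*/\hat k^{*3})\to(\mathrm{Im}\,\hat k^* )/k^{*3}\times U(\hat k^*/\hat k^{*3})/Z_2$ by $\hat\pi([\xi,\alpha])=([\xi],[\alpha])$ and $J_{\widehat{\mathcal{O}}_{[1]}}:\mathcal{O}(\hat k)\to(\mathrm{Im}\,\hat k^* )/k^{*3}\times U(\hat k^*/\hat k^{*3})/Z_2$ by $J_{\widehat{\mathcal{O}}_{[1]}}=\hat\pi\circ I_{\widehat{\mathcal{O}}_{[1]}}$. (i) Let $P,P'\in\mathcal{O}(\hat k)$. Then $\mathrm{Gl}(2,k)\cdot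 P=\mathrm{Gl}(2,k)\cdot P'$ if and only if $J_{\widehat{\mathcal{O}}_{[1]}}(P)=J_{\widehat{\mathcal{O}}_{[1]}}(P')$. (ii) The map $J_{\widehat{\mathcal{O}}_{[1]}}$ induces a bijection from $\mathcal{O}(\hat k)/\mathrm{Gl}(2,k)$ onto $(\mathrm{Im}\,\hat k^* )/k^{*3}\times U(\hat k^*/\hat k^{*3})/Z_2$.
   Context: $k$ is a field of characteristic different from $2$ and $3$; $x,y$ is the standard coordinate basis of $(k^2)^*$; $S^3((k^2)^* )=\{ax^3+3bx^2y+3cxy^2+dy^3: a,b,c,d\in k\}$ is the space of binary cubics. $\mathrm{Gl}(2,k)$ acts on $(k^2)^*$ by transpose inverse, $(g\cdot\phi)(v)=\phi(g^{-1}v)$, and functorially on $S^3((k^2)^* )$. The symplectic form is $\omega(P,P')=ad'-da'-3bc'+3cb'$ for $P=ax^3+3bx^2y+3cxy^2+dy^3$, $P'=a'x^3+3b'x^2y+3c'xy^2+d'y^3$, and $Q_n(P)=a^2d^2-3b^2c^2-6abcd+4b^3d+4ac^3$. One has $Q_n(g\cdot P)=(\det g)^{-6}Q_n(P)$ for $g\in\mathrm{Gl}(2,k)$. $\mathcal{O}_{[1]}=\{P: Q_n(P)\in{k^*}^2\}$. $T=\{\lambda\phi^3:\lambda\in k^*,0\ne\phi\in(k^2)^*\}$ and $I_T:T\to k^*/k^{*3}$, $I_T(\lambda\phi^3)=[\lambda]$. Every $P\in\mathcal{O}_{[1]}$ is $T_1+T_2$ with $T_1,T_2\in T$ coprime and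 unique up to permutation. $k^*\times_{Z_2}k^*/{k^*}^3$ is the quotient of $k^*\times(k^*/k^{*3})$ by the $Z_2$-action $-1\cdot(\lambda,\alpha)=(-\lambda,\alpha^{-1})$, with classes $[\lambda,\alpha]$, and $I_{\mathcal{O}_{[1]}}(P)=[\omega(T_1,T_2),I_T(T_1)I_T(T_2)^{-1}]$. $(k^*/k^{*3})/Z_2$ is the quotient set of $k^*/k^{*3}$ by inversion. For the quadratic extension $\hat k/k$, $z\mapsto\bar z$ denotes the action of the generator of $\mathrm{Gal}(\hat k/k)\cong Z_2$ on $\hat k$ and on any space obtained by base extension from $k$; $\hat\omega$ is the base extension of $\omega$. $\mathrm{Im}\,\hat k=\{\lambda\in\hat k:\bar\lambda=-\lambda\}$, with nonzero elements $\mathrm{Im}\,\hat k^*$; $(\mathrm{Im}\,\hat k^* )/k^{*3}$ is the quotient of $\mathrm{Im}\,\hat k^*$ by multiplication by $k^{*3}$. $U(\hat k^*/\hat k^{*3})=\{\alpha\in\hat k^*/\hat k^{*3}:\alpha\bar\alpha=1\}$, and $U(\hat k^*/\hat k^{*3})/Z_2$ is its quotient set by conjugation (equivalently inversion). $\mathrm{Im}\,\hat k^*\times_{Z_2}U(\hat k^*/\hat k^{*3})$ is the quotient of the product by $-1\cdot(\xi,\alpha)=(-\xi,\alpha^{-1})$. $\mathcal{O}(\hat k)=\{P\in S^3((k^2)^* ): Q_n(P)\in(\mathrm{Im}\,\hat k^* )^2\}$, where $(\mathrm{Im}\,\hat k^* )^2=\{q^2:q\in\mathrm{Im}\,\hat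 k^*\}$. Every $P\in\mathcal{O}(\hat k)$ is $\lambda\alpha^3+\bar\lambda\bar\alpha^3$ with $\lambda\in\hat k^*$, $\alpha\in(\hat k^2)^*$, $\alpha,\bar\alpha$ linearly independent, the unordered pair of summands being unique, and $I_{\widehat{\mathcal{O}}_{[1]}}(P)=[\hat\omega(\lambda\alpha^3,\bar\lambda\bar\alpha^3),[\lambda\bar\lambda^{-1}]]$. *)

theory Defs
  imports
    "HOL-Analysis.Determinants"
    "HOL-Computational_Algebra.Polynomial"
    "HOL-Algebra.Group_Action"
begin

section \<open>Binary cubics\<close>

text \<open>
  Polynomial functions on the plane are taken in \<open>'a[x][y]\<close>: the coefficient of
  \<open>x^i y^j\<close> in \<open>P\<close> is \<open>coeff (coeff P j) i\<close>, and the scalar \<open>c\<close> is \<open>[:[:c:]:]\<close>.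
\<close>

definition var_x :: "'a::field poly poly" where "var_x = [:[:0, 1:]:]"
definition var_y :: "'a::field poly poly" where "var_y = [:0, 1:]"

definition scale :: "'a::field \<Rightarrow> 'a poly poly \<Rightarrow> 'a poly poly"
  where "scale c P = smult [:c:] P"

definition lin_form :: "'a::field ^ 2 \<Rightarrow> 'a poly poly"
  where "lin_form p = scale (p $ 1) var_x + scale (p $ 2) var_y"

definition cubic :: "'a::field \<Rightarrow> 'a \<Rightarrow> 'a \<Rightarrow> 'a \<Rightarrow> 'a poly poly"
  where "cubic a b c d = scale a (var_x ^ 3) + scale (3 * b) (var_x ^ 2 * var_y)
                       + scale (3 * c) (var_x * var_y ^ 2) + scale d (var_y ^ 3)"

definition cubics :: "'a::field poly poly set"
  where "cubics = {cubic a b c d | a b c d. True}"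

text \<open>The coordinates \<open>a, b, c, d\<close> of a binary cubic; the division by 3 undoes the
  binomial normalisation, so this is only meaningful in characteristic different from 3.\<close>

definition coef_a :: "'a::field poly poly \<Rightarrow> 'a" where "coef_a P = coeff (coeff P 0) 3"
definition coef_b :: "'a::field poly poly \<Rightarrow> 'a" where "coef_b P = coeff (coeff P 1) 2 / 3"
definition coef_c :: "'a::field poly poly \<Rightarrow> 'a" where "coef_c P = coeff (coeff P 2) 1 / 3"
definition coef_d :: "'a::field poly poly \<Rightarrow> 'a" where "coef_d P = coeff (coeff P 3) 0"

definition omega :: "'a::field poly poly \<Rightarrow> 'a poly poly \<Rightarrow> 'a"
  where "omega P P' = coef_a P * coef_d P' - coef_d P * coef_a P'
                    - 3 * (coef_b P * coef_c P') + 3 * (coef_c P * coef_b P')"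

definition Qn :: "'a::field poly poly \<Rightarrow> 'a"
  where "Qn P = (let a = coef_a P; b = coef_b P; c = coef_c P; d = coef_d P in
           a^2 * d^2 - 3 * b^2 * c^2 - 6 * a * b * c * d + 4 * b^3 * d + 4 * a * c^3)"

section \<open>The action of the general linear group\<close>

definition GL2 :: "('a::field ^ 2 ^ 2) monoid"
  where "GL2 = \<lparr>carrier = {g. invertible g}, monoid.mult = (**), one = mat 1\<rparr>"

definition subst_xy :: "'a::field poly poly \<Rightarrow> 'a poly poly \<Rightarrow> 'a poly poly \<Rightarrow> 'a poly poly"
  where "subst_xy u v P = poly (map_poly (\<lambda>p. poly (map_poly (\<lambda>c. [:[:c:]:]) p) u) P) v"

text \<open>The coordinate functions satisfy \<open>g \<cdot> x = x \<circ> g\<inverse>\<close> and \<open>g \<cdot> y = y \<circ> g\<inverse>\<close>,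
  which are the linear forms given by the rows of \<open>g\<inverse>\<close>; the action is extended
  multiplicatively.\<close>

definition act :: "'a::field ^ 2 ^ 2 \<Rightarrow> 'a poly poly \<Rightarrow> 'a poly poly"
  where "act g = subst_xy (lin_form (matrix_inv g $ 1)) (lin_form (matrix_inv g $ 2))"

text \<open>As a check: on values, the action is \<open>(g \<cdot> P)(v) = P(g\<inverse> v)\<close>.\<close>

definition eval_at :: "'a::field poly poly \<Rightarrow> 'a ^ 2 \<Rightarrow> 'a"
  where "eval_at P v = poly (poly P [:v $ 2:]) (v $ 1)"

lemma eval_at_simps:
  "eval_at (P + Q) v = eval_at P v + eval_at Q v" "eval_at (P * Q) v = eval_at P v * eval_at Q v"
  "eval_at 0 v = 0" "eval_at [:[:c:]:] v = c"
  "eval_at (lin_form p) v = p $ 1 * v $ 1 + p $ 2 * v $ 2"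
  by (simp_all add: eval_at_def lin_form_def scale_def var_x_def var_y_def)

lemma eval_at_subst_xy:
  "eval_at (subst_xy u v P) w = eval_at P (vector [eval_at u w, eval_at v w])"
proof -
  have inner: "eval_at (poly (map_poly (\<lambda>c. [:[:c:]:]) p) u) w = poly p (eval_at u w)" for p
    by (induction p) (simp_all add: map_poly_pCons eval_at_simps)
  have "eval_at (subst_xy u v P) w = poly (poly P [:eval_at v w:]) (eval_at u w)"
    unfolding subst_xy_def
    by (induction P) (simp_all add: map_poly_pCons eval_at_simps inner)
  then show ?thesis by (simp add: eval_at_def)
qed

lemma eval_at_act: "eval_at (act g P) v = eval_at P (matrix_inv g *v v)"
proof -
  have "vector [eval_at (lin_form (matrix_inv g $ 1)) v, eval_at (lin_form (matrix_inv g $ 2)) v]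
      = matrix_inv g *v v"
    by (simp add: vec_eq_iff forall_2 eval_at_simps matrix_vector_mult_def sum_2)
  then show ?thesis by (simp add: act_def eval_at_subst_xy)
qed

section \<open>Cube classes and quotients by involutions\<close>

definition mult_group :: "'a::field monoid"
  where "mult_group = \<lparr>carrier = UNIV - {0}, monoid.mult = (*), one = 1\<rparr>"

definition cubes :: "'a::field set"
  where "cubes = {t ^ 3 | t. t \<noteq> 0}"

definition cube_classes :: "'a::field set monoid"
  where "cube_classes = mult_group Mod cubes"

definition cube_class :: "'a::field \<Rightarrow> 'a set"
  where "cube_class c = cubes #>\<^bsub>mult_group\<^esub> c"

text \<open>Orbit equivalence relation on \<open>X\<close> of the \<open>Z_2\<close>-action generated by the involution \<open>\<tau>\<close>.\<close>

definition Z2_rel :: "'a set \<Rightarrow> ('a \<Rightarrow> 'a) \<Rightarrow> ('a \<times> 'a) set"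
  where "Z2_rel X \<tau> = {(z, w). z \<in> X \<and> w \<in> X \<and> (w = z \<or> w = \<tau> z)}"

definition neg_inv :: "'a::field \<times> 'a set \<Rightarrow> 'a \<times> 'a set"
  where "neg_inv = (\<lambda>(\<xi>, \<alpha>). (- \<xi>, inv\<^bsub>cube_classes\<^esub> \<alpha>))"

section \<open>The split case\<close>

definition O1 :: "'a::field poly poly set"
  where "O1 = {P \<in> cubics. Qn P \<in> {q ^ 2 | q. q \<noteq> 0}}"

definition T_set :: "'a::field poly poly set"
  where "T_set = {scale \<mu> (lin_form \<phi> ^ 3) | \<mu> \<phi>. \<mu> \<noteq> 0 \<and> \<phi> \<noteq> 0}"

text \<open>Here and below, a map defined through a choice of representatives is the unique element
  of the set of values obtained from all admissible choices.\<close>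

definition I_T :: "'a::field poly poly \<Rightarrow> 'a set"
  where "I_T P = the_elem {cube_class \<mu> | \<mu> \<phi>. \<mu> \<noteq> 0 \<and> \<phi> \<noteq> 0 \<and> P = scale \<mu> (lin_form \<phi> ^ 3)}"

definition prod_rel :: "(('a::field \<times> 'a set) \<times> ('a \<times> 'a set)) set"
  where "prod_rel = Z2_rel ((UNIV - {0}) \<times> carrier cube_classes) neg_inv"

definition I_O1 :: "'a::field poly poly \<Rightarrow> ('a \<times> 'a set) set"
  where "I_O1 P = the_elem
    {prod_rel `` {(omega T1 T2, I_T T1 \<otimes>\<^bsub>cube_classes\<^esub> inv\<^bsub>cube_classes\<^esub> (I_T T2))} | T1 T2.
       T1 \<in> T_set \<and> T2 \<in> T_set \<and> coprime T1 T2 \<and> P = T1 + T2}"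

definition inv_rel :: "('a::field set \<times> 'a set) set"
  where "inv_rel = Z2_rel (carrier cube_classes) (\<lambda>\<alpha>. inv\<^bsub>cube_classes\<^esub> \<alpha>)"

definition J_target :: "('a::field set \<times> 'a set set) set"
  where "J_target = carrier cube_classes \<times> (carrier cube_classes // inv_rel)"

definition proj_pi :: "('a::field \<times> 'a set) set \<Rightarrow> 'a set \<times> 'a set set"
  where "proj_pi C = the_elem ((\<lambda>(\<xi>, \<alpha>). (cube_class \<xi>, inv_rel `` {\<alpha>})) ` C)"

definition J_O1 :: "'a::field poly poly \<Rightarrow> 'a set \<times> 'a set set"
  where "J_O1 = proj_pi \<circ> I_O1"

section \<open>Quadratic extensions\<close>

definition field_hom :: "('a::field \<Rightarrow> 'b::field) \<Rightarrow> bool"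
  where "field_hom f \<longleftrightarrow> f 1 = 1 \<and> (\<forall>a b. f (a + b) = f a + f b) \<and> (\<forall>a b. f (a * b) = f a * f b)"

text \<open>An extension of fields is given by its embedding \<open>\<iota>\<close>. The dimension is 0 by convention
  when there is no finite basis, so the condition below does force degree 2.\<close>

definition quadratic_extension :: "('k::field \<Rightarrow> 'K::field) \<Rightarrow> bool"
  where "quadratic_extension \<iota> \<longleftrightarrow>
    field_hom \<iota> \<and> vector_space.dim (\<lambda>c z. \<iota> c * z) (UNIV :: 'K set) = 2"

definition Gal :: "('k::field \<Rightarrow> 'K::field) \<Rightarrow> ('K \<Rightarrow> 'K) set"
  where "Gal \<iota> = {\<sigma>. field_hom \<sigma> \<and> bij \<sigma> \<and> (\<forall>c. \<sigma> (\<iota> c) = \<iota> c)}"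

definition conj_K :: "('k::field \<Rightarrow> 'K::field) \<Rightarrow> 'K \<Rightarrow> 'K"
  where "conj_K \<iota> = (THE \<sigma>. \<sigma> \<in> Gal \<iota> \<and> \<sigma> \<noteq> id)"

definition base_ext :: "('k::field \<Rightarrow> 'K::field) \<Rightarrow> 'k poly poly \<Rightarrow> 'K poly poly"
  where "base_ext \<iota> = map_poly (map_poly \<iota>)"

definition conj_form :: "('k::field \<Rightarrow> 'K::field) \<Rightarrow> 'K poly poly \<Rightarrow> 'K poly poly"
  where "conj_form \<iota> = map_poly (map_poly (conj_K \<iota>))"

definition conj_class :: "('k::field \<Rightarrow> 'K::field) \<Rightarrow> 'K set \<Rightarrow> 'K set"
  where "conj_class \<iota> \<alpha> = conj_K \<iota> ` \<alpha>"

definition Im_units :: "('k::field \<Rightarrow> 'K::field) \<Rightarrow> 'K set"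
  where "Im_units \<iota> = {z. conj_K \<iota> z = - z \<and> z \<noteq> 0}"

definition Im_rel :: "('k::field \<Rightarrow> 'K::field) \<Rightarrow> ('K \<times> 'K) set"
  where "Im_rel \<iota> = {(z, w). z \<in> Im_units \<iota> \<and> w \<in> Im_units \<iota> \<and> (\<exists>t \<in> cubes. w = \<iota> t * z)}"

definition U_classes :: "('k::field \<Rightarrow> 'K::field) \<Rightarrow> 'K set set"
  where "U_classes \<iota> =
    {\<alpha> \<in> carrier cube_classes. \<alpha> \<otimes>\<^bsub>cube_classes\<^esub> conj_class \<iota> \<alpha> = \<one>\<^bsub>cube_classes\<^esub>}"

section \<open>The case of a quadratic extension\<close>

definition O_hat :: "('k::field \<Rightarrow> 'K::field) \<Rightarrow> 'k poly poly set"
  where "O_hat \<iota> = {P \<in> cubics. \<iota> (Qn P) \<in> {q ^ 2 | q. q \<in> Im_units \<iota>}}"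

definition lin_indep_pair :: "'a::field poly poly \<Rightarrow> 'a poly poly \<Rightarrow> bool"
  where "lin_indep_pair P P' \<longleftrightarrow> (\<forall>s t. scale s P + scale t P' = 0 \<longrightarrow> s = 0 \<and> t = 0)"

definition prod_rel_hat :: "('k::field \<Rightarrow> 'K::field) \<Rightarrow> (('K \<times> 'K set) \<times> ('K \<times> 'K set)) set"
  where "prod_rel_hat \<iota> = Z2_rel (Im_units \<iota> \<times> U_classes \<iota>) neg_inv"

definition I_O_hat :: "('k::field \<Rightarrow> 'K::field) \<Rightarrow> 'k poly poly \<Rightarrow> ('K \<times> 'K set) set"
  where "I_O_hat \<iota> P = the_elem
    {prod_rel_hat \<iota> `` {(omega (scale \<mu> (\<alpha> ^ 3)) (scale (conj_K \<iota> \<mu>) (conj_form \<iota> \<alpha> ^ 3)),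
                        cube_class (\<mu> * inverse (conj_K \<iota> \<mu>)))} | \<mu> \<alpha>.
       \<mu> \<noteq> 0 \<and> \<alpha> \<in> range lin_form \<and> lin_indep_pair \<alpha> (conj_form \<iota> \<alpha>) \<and>
       base_ext \<iota> P = scale \<mu> (\<alpha> ^ 3) + scale (conj_K \<iota> \<mu>) (conj_form \<iota> \<alpha> ^ 3)}"

definition conj_rel :: "('k::field \<Rightarrow> 'K::field) \<Rightarrow> ('K set \<times> 'K set) set"
  where "conj_rel \<iota> = Z2_rel (U_classes \<iota>) (conj_class \<iota>)"

definition J_hat_target :: "('k::field \<Rightarrow> 'K::field) \<Rightarrow> ('K set \<times> 'K set set) set"
  where "J_hat_target \<iota> = (Im_units \<iota> // Im_rel \<iota>) \<times> (U_classes \<iota> // conj_rel \<iota>)"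

definition proj_pi_hat :: "('k::field \<Rightarrow> 'K::field) \<Rightarrow> ('K \<times> 'K set) set \<Rightarrow> 'K set \<times> 'K set set"
  where "proj_pi_hat \<iota> C = the_elem ((\<lambda>(\<xi>, \<alpha>). (Im_rel \<iota> `` {\<xi>}, conj_rel \<iota> `` {\<alpha>})) ` C)"

definition J_O_hat :: "('k::field \<Rightarrow> 'K::field) \<Rightarrow> 'k poly poly \<Rightarrow> 'K set \<times> 'K set set"
  where "J_O_hat \<iota> = proj_pi_hat \<iota> \<circ> I_O_hat \<iota>"

end

theory Submission
  imports Defs
begin

text \<open>
  A cubic \<open>P\<close> whose quartic invariant is a nonzero square \<open>q\<^sup>2\<close> is a sum of two coprime cubes
  \<open>l \<phi>\<^sup>3 + m \<psi>\<^sup>3\<close>. Both summands are given by a closed formula: if \<open>\<Psi>\<close> is the cubic covariant of \<open>P\<close>,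
  they are \<open>(P + \<Psi> / q) / 2\<close> and \<open>(P - \<Psi> / q) / 2\<close>, and \<open>q = l m [\<phi>, \<psi>]\<^sup>3\<close> is the symplectic product of
  the summands, where \<open>[\<phi>, \<psi>]\<close> is the determinant of the two forms (\<open>half_cubic_cube\<close>,
  \<open>half_cubic_sum_of_cubes\<close>). Since \<open>q\<close> is determined up to sign by \<open>P\<close>, the formula gives both
  existence and uniqueness up to order (\<open>cubic_eq_cube_sum\<close>, \<open>cube_sum_unique\<close>), and it does so over
  any field of characteristic different from 2 and 3.

  In the split case the invariant of \<open>P\<close> therefore amounts to the class \<open>[l m]\<close> modulo cubes together
  with the class \<open>[l / m]\<close> up to inversion. Linear substitutions move \<open>\<phi>\<close> and \<open>\<psi>\<close> only, and
  they act transitively on pairs of independent linear forms. If the two classes agree for two cubics,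
  then, after exchanging summands if necessary, \<open>l\<^sup>2 = (l m) (l / m)\<close> and \<open>l'\<^sup>2\<close> differ by a cube, hence
  so do \<open>l\<close> and \<open>l'\<close>, and likewise \<open>m\<close> and \<open>m'\<close> (\<open>ratio_is_cube\<close>). These cubes are absorbed
  into the linear forms. Conversely, for all \<open>a, b \<noteq> 0\<close> the equations \<open>[l m] = [a]\<close>, \<open>[l / m] = [b]\<close>
  are solvable, and \<open>l x\<^sup>3 + m y\<^sup>3\<close> realises the pair of classes.

  For a quadratic extension the root \<open>q\<close> is purely imaginary, so conjugation exchanges the two
  summands and \<open>P = l \<phi>\<^sup>3 + conj (l \<phi>\<^sup>3)\<close> (\<open>O_hat_trace_cube\<close>). The argument over the ground field is
  then carried out over the extension and descended at three places. The independent pairs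
  \<open>(\<phi>, conj \<phi>)\<close> are permuted transitively already by matrices over the ground field, because the
  coordinates of \<open>\<phi>\<close> with respect to \<open>1, s\<close> form an independent pair there
  (\<open>descended_transitivity\<close>). A norm that is a cube in the extension is a cube in the ground field
  (\<open>norm_cube_descends\<close>). Finally, with \<open>s\<^sup>2 = \<delta>\<close>, the cubic with \<open>l = (\<delta> / e) / \<beta>\<close> and
  \<open>\<phi> = x + s y\<close> realises the pair of classes of \<open>e s\<close> and \<open>\<beta>\<close>.
\<close>

section \<open>Binary cubics in coordinates\<close>

text \<open>The determinant of two linear forms, which vanishes exactly when they are dependent.\<close>

definition br :: "'a::field ^ 2 \<Rightarrow> 'a ^ 2 \<Rightarrow> 'a"
  where "br p r = p $ 1 * r $ 2 - p $ 2 * r $ 1"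

lemma br_swap: "br r p = - br p r"
  by (simp add: br_def)

lemma nonzero_if_br_neq_0: "br p r \<noteq> 0 \<Longrightarrow> p \<noteq> 0" "br p r \<noteq> 0 \<Longrightarrow> r \<noteq> 0"
  by (auto simp: br_def)

lemma cubic_eq_poly: "cubic a b c d = [:[:0, 0, 0, a:], [:0, 0, 3 * b:], [:0, 3 * c:], [:d:]:]"
  by (simp add: cubic_def scale_def var_x_def var_y_def power3_eq_cube power2_eq_square)

lemma coef_cubic:
  assumes "(3::'a::field) \<noteq> 0"
  shows "coef_a (cubic a b c d) = (a::'a)" "coef_b (cubic a b c d) = b"
    "coef_c (cubic a b c d) = c" "coef_d (cubic a b c d) = d"
  using assms
  by (simp_all add: cubic_eq_poly coef_a_def coef_b_def coef_c_def coef_d_def numeral_eq_Suc)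

lemma cubic_inject:
  assumes "(3::'a::field) \<noteq> 0"
  shows "cubic a b c d = cubic a' b' c' d' \<longleftrightarrow> a = (a'::'a) \<and> b = b' \<and> c = c' \<and> d = d'"
  using assms by (auto simp add: cubic_eq_poly)

lemma cubic_add: "cubic a b c d + cubic a' b' c' d' = cubic (a + a') (b + b') (c + c') (d + d')"
  by (simp add: cubic_eq_poly algebra_simps)

lemma lin_form_eq_poly: "lin_form p = [:[:0, p $ 1:], [:p $ 2:]:]"
  by (simp add: lin_form_def scale_def var_x_def var_y_def)

lemma scale_cube_lin_form:
  "scale m (lin_form p ^ 3) =
    cubic (m * (p $ 1) ^ 3) (m * (p $ 1) ^ 2 * p $ 2) (m * p $ 1 * (p $ 2) ^ 2) (m * (p $ 2) ^ 3)"
  by (simp add: cubic_eq_poly lin_form_eq_poly scale_def power3_eq_cube power2_eq_square algebra_simps)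

lemma omega_cubes:
  assumes "(3::'a::field) \<noteq> 0"
  shows "omega (scale l (lin_form p ^ 3)) (scale m (lin_form r ^ 3)) = l * m * br p (r::'a^2) ^ 3"
  by (simp add: scale_cube_lin_form omega_def coef_cubic[OF assms] br_def) algebra

text \<open>The cubic with coordinates \<open>a, b, c, d\<close>, plus \<open>1 / q\<close> times its cubic covariant, halved. The numerators
  over \<open>q\<close> are the coordinates of the covariant; for \<open>l x\<^sup>3 + m y\<^sup>3\<close> the covariant is
  \<open>l m (l x\<^sup>3 - m y\<^sup>3)\<close>, so \<open>q = l m\<close> singles out the summand \<open>l x\<^sup>3\<close>.\<close>

definition half_cubic :: "'a::field \<Rightarrow> 'a \<Rightarrow> 'a \<Rightarrow> 'a \<Rightarrow> 'a \<Rightarrow> 'a poly poly"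
  where "half_cubic q a b c d = cubic
    ((a + (a^2 * d - 3 * a * b * c + 2 * b^3) / q) / 2)
    ((b + (a * b * d - 2 * a * c^2 + b^2 * c) / q) / 2)
    ((c - (a * c * d - 2 * b^2 * d + b * c^2) / q) / 2)
    ((d - (a * d^2 - 3 * b * c * d + 2 * c^3) / q) / 2)"

lemma Qn_cubic:
  assumes "(3::'a::field) \<noteq> 0"
  shows "Qn (cubic a b c d) = a^2 * d^2 - 3 * b^2 * c^2 - 6 * a * b * c * d + 4 * b^3 * d + 4 * a * (c::'a)^3"
  by (simp add: Qn_def coef_cubic[OF assms] Let_def)

lemma half_cubic_add:
  assumes "(2::'a::field) \<noteq> 0"
  shows "half_cubic q a b c d + half_cubic (- q) a b c d = cubic a b c (d::'a)"
proof -
  have h: "(x + y) / 2 + (x - y) / 2 = x" "(x - y) / 2 + (x + y) / 2 = x" for x y :: 'a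
    using assms by (simp_all flip: add_divide_distrib mult_2)
  show ?thesis
    by (simp add: half_cubic_def cubic_add h)
qed

text \<open>The three equations say that \<open>(a, b, c)\<close> and \<open>(b, c, d)\<close> are linearly dependent. So, if \<open>a \<noteq> 0\<close>, the
  coordinates form a geometric progression of ratio \<open>b / a\<close>; if \<open>a = 0\<close>, only \<open>d\<close> survives.\<close>

lemma cube_of_rank_one:
  assumes "a * c = b^2" "b * d = c^2" "a * d = b * (c::'a::field)"
  shows "\<exists>m p. cubic a b c d = scale m (lin_form p ^ 3)"
proof (cases "a = 0")
  case True
  then have "b = 0" "c = 0" using assms by auto
  then have "cubic a b c d = scale d (lin_form (vector [0, 1]) ^ 3)"
    using True by (simp add: scale_cube_lin_form)
  then show ?thesis by blast
next
  case False
  have "c = b^2 / a" "d = b^3 / a^2"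
    using assms False by (simp_all add: field_simps) algebra
  then have "cubic a b c d = scale a (lin_form (vector [1, b / a]) ^ 3)"
    using False unfolding scale_cube_lin_form by (simp add: power2_eq_square power3_eq_cube)
  then show ?thesis by blast
qed

text \<open>Each rank-one equation for the coordinates of \<open>half_cubic\<close> is, after clearing denominators, a multiple
  of the equation \<open>Qn P = q\<^sup>2\<close>.\<close>

lemma half_cubic_cube:
  assumes "(2::'a::field) \<noteq> 0" "(3::'a) \<noteq> 0" "Qn (cubic a b c d) = q^2" "(q::'a) \<noteq> 0"
  shows "\<exists>m p. half_cubic q a b c d = scale m (lin_form p ^ 3)"
proof -
  define e where "e = inverse (2 * q)"
  have e: "2 * q * e = 1" using assms by (simp add: e_def)
  have Q: "q^2 = a^2 * d^2 - 3 * b^2 * c^2 - 6 * a * b * c * d + 4 * b^3 * d + 4 * a * c^3"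
    using assms Qn_cubic by metis
  have h: "(x + y / q) / 2 = e * (q * x + y)" "(x - y / q) / 2 = e * (q * x - y)" for x y
    using assms by (simp_all add: e_def field_simps)
  show ?thesis
    unfolding half_cubic_def h
  proof (rule cube_of_rank_one, goal_cases)
    case 1
    show ?case using Q by algebra
  next
    case 2
    show ?case using Q by algebra
  next
    case 3
    show ?case using Q by algebra
  qed
qed

text \<open>The covariant of a sum of two cubes is a multiple of their difference, with factor
  \<open>l m [p, r]\<^sup>3\<close>. Hence the summands can be recovered from the sum and this number alone, and the number
  is determined up to sign by the sum. All uniqueness statements below rest on this.\<close>

lemma
  fixes p r :: "'a::field^2"
  assumes "(2::'a) \<noteq> 0" "(3::'a) \<noteq> 0"
    "cubic a b c d = scale l (lin_form p ^ 3) + scale m (lin_form r ^ 3)"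
  shows Qn_sum_of_cubes: "Qn (cubic a b c d) = (l * m * br p r ^ 3)^2"
    and half_cubic_sum_of_cubes: "l * m * br p r ^ 3 \<noteq> 0 \<Longrightarrow>
      half_cubic (l * m * br p r ^ 3) a b c d = scale l (lin_form p ^ 3)"
proof -
  have co: "a = l * (p $ 1) ^ 3 + m * (r $ 1)^3" "b = l * (p $ 1) ^ 2 * p $ 2 + m * (r $ 1) ^ 2 * r $ 2"
     "c = l * p $ 1 * (p $ 2) ^ 2 + m * r $ 1 * (r $ 2) ^ 2" "d = l * (p $ 2) ^ 3 + m * (r $ 2) ^ 3"
    using assms(3) unfolding scale_cube_lin_form cubic_add cubic_inject[OF assms(2)] by auto
  define q where "q = l * m * br p r ^ 3"
  show "Qn (cubic a b c d) = (l * m * br p r ^ 3)^2"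
    unfolding Qn_cubic[OF assms(2)] co br_def by algebra
  assume "l * m * br p r ^ 3 \<noteq> 0"
  then have "q \<noteq> 0" by (simp add: q_def)
  then have h: "(x + y / q) / 2 = z" if "y = q * (2 * z - x)" for x y z
    using that assms(1) by (simp add: field_simps)
  have h': "(x - y / q) / 2 = z" if "y = q * (x - 2 * z)" for x y z
  proof -
    have "y / q = x - 2 * z" using that \<open>q \<noteq> 0\<close> by simp
    then show ?thesis using assms(1) by simp
  qed
  show "half_cubic (l * m * br p r ^ 3) a b c d = scale l (lin_form p ^ 3)"
    unfolding scale_cube_lin_form half_cubic_def q_def[symmetric] cubic_inject[OF assms(2)]
    by (intro conjI h h'; unfold co q_def br_def; algebra)
qed

section \<open>Cube classes\<close>

lemma mult_group_simps [simp]: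
  "carrier mult_group = UNIV - {0}" "x \<otimes>\<^bsub>mult_group\<^esub> y = x * y" "\<one>\<^bsub>mult_group\<^esub> = 1"
  by (simp_all add: mult_group_def)

lemma comm_group_mult_group: "comm_group (mult_group :: 'a::field monoid)"
proof (rule comm_groupI)
  fix x :: 'a assume "x \<in> carrier mult_group"
  then show "\<exists>y\<in>carrier mult_group. y \<otimes>\<^bsub>mult_group\<^esub> x = \<one>\<^bsub>mult_group\<^esub>"
    by (intro bexI[of _ "inverse x"]) auto
qed (auto simp: mult_ac)

lemma inv_mult_group: "(x::'a::field) \<noteq> 0 \<Longrightarrow> inv\<^bsub>mult_group\<^esub> x = inverse x"
  by (rule group.inv_equality[OF comm_group.axioms(2)[OF comm_group_mult_group]]) auto

text \<open>With this, the quotient group laws become available for \<open>cube_classes\<close>, and all computations in it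
  reduce to computations with representatives.\<close>

lemma normal_cubes: "normal cubes (mult_group :: 'a::field monoid)"
proof -
  have "subgroup cubes (mult_group :: 'a monoid)"
  proof (rule group.subgroupI[OF comm_group.axioms(2)[OF comm_group_mult_group]])
    show "cubes \<subseteq> carrier (mult_group :: 'a monoid)" "cubes \<noteq> ({} :: 'a set)"
      by (auto simp: cubes_def intro!: exI[of _ 1])
  next
    fix a :: 'a assume "a \<in> cubes"
    then obtain t where t: "a = t ^ 3" "t \<noteq> 0" by (auto simp: cubes_def)
    then have "inv\<^bsub>mult_group\<^esub> a = inverse t ^ 3" "inverse t \<noteq> 0" 
      by (simp_all add: inv_mult_group power_inverse)
    then show "inv\<^bsub>mult_group\<^esub> a \<in> cubes" unfolding cubes_def by blast
  next
    fix a b :: 'a assume "a \<in> cubes" "b \<in> cubes"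
    then obtain t u where "a = t ^ 3" "t \<noteq> 0" "b = u ^ 3" "u \<noteq> 0" by (auto simp: cubes_def)
    then have "a \<otimes>\<^bsub>mult_group\<^esub> b = (t * u) ^ 3" "t * u \<noteq> 0" by (simp_all add: power_mult_distrib)
    then show "a \<otimes>\<^bsub>mult_group\<^esub> b \<in> cubes" unfolding cubes_def by blast
  qed
  then show ?thesis
    by (rule comm_group.subgroup_imp_normal[OF comm_group_mult_group])
qed

lemma group_cube_classes: "group (cube_classes :: 'a::field set monoid)"
  unfolding cube_classes_def by (rule normal.factorgroup_is_group[OF normal_cubes])

lemma carrier_cube_classes: "carrier cube_classes = {cube_class c | c::'a::field. c \<noteq> 0}"
  by (auto simp: cube_classes_def carrier_FactGroup cube_class_def)

lemma cube_class_in_carrier: "(a::'a::field) \<noteq> 0 \<Longrightarrow> cube_class a \<in> carrier cube_classes"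
  by (auto simp: carrier_cube_classes)

lemma cube_class_mult:
  "\<lbrakk>(a::'a::field) \<noteq> 0; b \<noteq> 0\<rbrakk> \<Longrightarrow> cube_class a \<otimes>\<^bsub>cube_classes\<^esub> cube_class b = cube_class (a * b)"
  using normal.rcos_sum[OF normal_cubes, of a b] by (simp add: cube_classes_def cube_class_def)

lemma one_cube_classes: "\<one>\<^bsub>cube_classes\<^esub> = cube_class (1::'a::field)"
  by (auto simp: cube_classes_def cube_class_def r_coset_def)

lemma cube_class_inv:
  assumes "(a::'a::field) \<noteq> 0"
  shows "inv\<^bsub>cube_classes\<^esub> (cube_class a) = cube_class (inverse a)"
  by (rule group.inv_equality[OF group_cube_classes])
    (use assms in \<open>simp_all add: cube_class_mult one_cube_classes cube_class_in_carrier\<close>)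

lemma cube_class_eq_set: "cube_class a = {t ^ 3 * a | t::'a::field. t \<noteq> 0}"
  by (auto simp: cube_class_def r_coset_def cubes_def)

lemma cube_class_eq_iff:
  "cube_class a = cube_class b \<longleftrightarrow> (\<exists>t. t \<noteq> 0 \<and> (a::'a::field) = t ^ 3 * b)"
proof
  assume "cube_class a = cube_class b"
  moreover have "a \<in> cube_class a"
    unfolding cube_class_eq_set by (auto intro!: exI[of _ 1])
  ultimately show "\<exists>t. t \<noteq> 0 \<and> a = t ^ 3 * b"
    by (auto simp: cube_class_eq_set)
next
  assume "\<exists>t. t \<noteq> 0 \<and> a = t ^ 3 * b"
  then obtain t where t: "t \<noteq> 0" "a = t ^ 3 * b" by blast
  have "u ^ 3 * a = (u * t) ^ 3 * b" "u ^ 3 * b = (u / t) ^ 3 * a" for u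
    using t by (simp_all add: power_mult_distrib power_divide)
  then have "u \<noteq> 0 \<Longrightarrow> \<exists>v. v \<noteq> 0 \<and> u ^ 3 * a = v ^ 3 * b"
    "u \<noteq> 0 \<Longrightarrow> \<exists>v. v \<noteq> 0 \<and> u ^ 3 * b = v ^ 3 * a" for u
    using t(1) by (metis mult_eq_0_iff, metis divide_eq_0_iff)
  then show "cube_class a = cube_class b"
    unfolding cube_class_eq_set by blast
qed

lemma cube_class_times_cube: "t \<noteq> 0 \<Longrightarrow> cube_class (a * t ^ 3) = cube_class (a::'a::field)"
  unfolding cube_class_eq_iff by (auto simp: mult.commute)

lemma cube_class_uminus: "cube_class (- a) = cube_class (a::'a::field)"
  using cube_class_times_cube[of "-1" a] by simp

lemma Z2_rel_class: "z \<in> X \<Longrightarrow> \<tau> z \<in> X \<Longrightarrow> Z2_rel X \<tau> `` {z} = {z, \<tau> z}"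
  by (auto simp: Z2_rel_def)

section \<open>Linear substitutions\<close>

lemma map_poly_add_hom:
  assumes "f 0 = 0" "\<And>x y. f (x + y) = f x + f y"
  shows "map_poly f (p + q) = map_poly f p + map_poly f q"
  by (rule poly_eqI) (simp add: coeff_map_poly assms)

lemma map_poly_mult_hom:
  fixes f :: "'a::comm_semiring_0 \<Rightarrow> 'b::comm_semiring_0"
  assumes "f 0 = 0" "\<And>x y. f (x + y) = f x + f y" "\<And>x y. f (x * y) = f x * f y"
  shows "map_poly f (p * q) = map_poly f p * map_poly f q"
proof -
  have s: "f (sum g A) = sum (f \<circ> g) A" for g :: "nat \<Rightarrow> 'a" and A
    using assms(1,2) by (rule sum_comp_morphism[symmetric])
  show ?thesis
    by (rule poly_eqI) (simp add: coeff_map_poly coeff_mult assms s)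
qed

lemma subst_xy_add: "subst_xy u v (P + Q) = subst_xy u v P + subst_xy u v Q"
  and subst_xy_mult: "subst_xy u v (P * Q) = subst_xy u v P * subst_xy u v Q"
proof -
  define h where "h = (\<lambda>p. poly (map_poly (\<lambda>c. [:[:c:]:]) p) u)"
  have h: "h 0 = 0" "h (p + q) = h p + h q" "h (p * q) = h p * h q" for p q
    by (simp_all add: h_def map_poly_add_hom map_poly_mult_hom)
  show "subst_xy u v (P + Q) = subst_xy u v P + subst_xy u v Q"
    "subst_xy u v (P * Q) = subst_xy u v P * subst_xy u v Q"
    unfolding subst_xy_def h_def[symmetric]
    by (simp_all add: map_poly_add_hom map_poly_mult_hom h)
qed

lemma subst_xy_simps:
  "subst_xy u v [:[:c:]:] = [:[:c:]:]" "subst_xy u v 0 = 0" "subst_xy u v 1 = 1"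
  "subst_xy u v var_x = u" "subst_xy u v var_y = v"
  by (simp_all add: subst_xy_def var_x_def var_y_def map_poly_pCons one_pCons)
    (simp_all flip: one_pCons)

lemma subst_xy_power: "subst_xy u v (P ^ n) = subst_xy u v P ^ n"
  by (induction n) (simp_all add: subst_xy_simps subst_xy_mult)

lemma scale_eq_mult: "scale c P = [:[:c:]:] * P"
  by (simp add: scale_def)

lemma subst_xy_scale: "subst_xy u v (scale c P) = scale c (subst_xy u v P)"
  by (simp add: scale_eq_mult subst_xy_mult subst_xy_simps del: mult_pCons_left)

text \<open>A map compatible with sums and products is controlled by its values on scalars and on the two
  variables. Multiplication by a variable, rather than by an arbitrary polynomial, keeps the induction
  steps to identities between linear forms.\<close>

lemma poly_poly_induct [case_names add const var_x var_y]:
  fixes P :: "'a::field poly poly"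
  assumes add: "\<And>P Q. S P \<Longrightarrow> S Q \<Longrightarrow> S (P + Q)"
    and const: "\<And>c. S [:[:c:]:]"
    and x: "\<And>P. S P \<Longrightarrow> S (var_x * P)" and y: "\<And>P. S P \<Longrightarrow> S (var_y * P)"
  shows "S P"
proof (induction P)
  case 0
  show ?case using const[of 0] by simp
next
  case (pCons p P)
  have "S [:p:]"
  proof (induction p)
    case 0
    show ?case using const[of 0] by simp
  next
    case (pCons c p)
    have "[:pCons c p:] = [:[:c:]:] + var_x * [:p:]" by (simp add: var_x_def)
    then show ?case using add const x pCons.IH by metis
  qed
  moreover have "pCons p P = [:p:] + var_y * P" by (simp add: var_y_def)
  ultimately show ?case using add y pCons.IH by metis
qed

text \<open>The action without the matrix inverse, which makes it a right action. Orbits do not change when the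
  inverse is dropped, and no inverses of matrices have to be computed.\<close>

definition lin_subst :: "'a::field ^ 2 ^ 2 \<Rightarrow> 'a poly poly \<Rightarrow> 'a poly poly"
  where "lin_subst M = subst_xy (lin_form (M $ 1)) (lin_form (M $ 2))"

lemma act_eq_lin_subst: "act g = lin_subst (matrix_inv g)"
  by (simp add: act_def lin_subst_def)

lemma lin_subst_lin_form: "lin_subst M (lin_form p) = lin_form (p v* M)"
  by (simp add: lin_subst_def lin_form_def[of p] subst_xy_add subst_xy_scale subst_xy_simps)
    (simp add: lin_form_def scale_def vector_matrix_mult_def sum_2 var_x_def var_y_def algebra_simps)

text \<open>The coefficient is unaffected, so the action only moves the linear form inside a cube.\<close>

lemma lin_subst_cube: "lin_subst M (scale m (lin_form p ^ 3)) = scale m (lin_form (p v* M) ^ 3)"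
  using lin_subst_lin_form[of M p] by (simp add: lin_subst_def subst_xy_scale subst_xy_power)

lemma lin_subst_add: "lin_subst M (P + Q) = lin_subst M P + lin_subst M Q"
  by (simp add: lin_subst_def subst_xy_add)

lemma lin_subst_mult: "lin_subst M (P * Q) = lin_subst M P * lin_subst M Q"
  by (simp add: lin_subst_def subst_xy_mult)

lemma lin_subst_var: "lin_subst M var_x = lin_form (M $ 1)" "lin_subst M var_y = lin_form (M $ 2)"
  by (simp_all add: lin_subst_def subst_xy_simps)

lemma lin_subst_lin_subst: "lin_subst M (lin_subst N P) = lin_subst (N ** M) P"
proof (induction P rule: poly_poly_induct)
  case (add P Q) then show ?case by (simp add: lin_subst_add)
next
  case (const c) show ?case by (simp add: lin_subst_def subst_xy_simps)
next
  case (var_x P)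
  have "lin_subst M (lin_subst N var_x) = lin_subst (N ** M) var_x"
    unfolding lin_subst_var lin_subst_lin_form
    by (simp add: vec_eq_iff matrix_matrix_mult_def vector_matrix_mult_def mult.commute)
  then show ?case using var_x by (simp only: lin_subst_mult)
next
  case (var_y P)
  have "lin_subst M (lin_subst N var_y) = lin_subst (N ** M) var_y"
    unfolding lin_subst_var lin_subst_lin_form
    by (simp add: vec_eq_iff matrix_matrix_mult_def vector_matrix_mult_def mult.commute)
  then show ?case using var_y by (simp only: lin_subst_mult)
qed

lemma lin_subst_mat_1: "lin_subst (mat 1) P = (P :: 'a::field poly poly)"
proof (induction P rule: poly_poly_induct)
  case (add P Q) then show ?case by (simp add: lin_subst_add)
next
  case (const c) show ?case by (simp add: lin_subst_def subst_xy_simps)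
next
  case (var_x P)
  have "lin_subst (mat 1) var_x = (var_x :: 'a poly poly)"
    by (simp add: lin_subst_var lin_form_def mat_def scale_def flip: one_pCons)
  then show ?case using var_x by (simp only: lin_subst_mult)
next
  case (var_y P)
  have "lin_subst (mat 1) var_y = (var_y :: 'a poly poly)"
    by (simp add: lin_subst_var lin_form_def mat_def scale_def flip: one_pCons)
  then show ?case using var_y by (simp only: lin_subst_mult)
qed

lemma matrix_inv_inverse:
  fixes g :: "'a::field^2^2"
  assumes "invertible g"
  shows "g ** matrix_inv g = mat 1" "matrix_inv g ** g = mat 1"
  using assms unfolding invertible_def matrix_inv_def
  by (metis (mono_tags, lifting) someI_ex)+

lemma invertible_matrix_inv: "invertible (g::'a::field^2^2) \<Longrightarrow> invertible (matrix_inv g)"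
  using matrix_inv_inverse unfolding invertible_def by blast

lemma orbit_GL2: "orbit GL2 act P = {lin_subst M P | M. invertible M}"
proof -
  have "\<exists>g. invertible g \<and> M = matrix_inv g" if M: "invertible M" for M :: "'a^2^2"
  proof (intro exI conjI)
    show "invertible (matrix_inv M)" using invertible_matrix_inv M by blast
    then show "M = matrix_inv (matrix_inv M)"
      using matrix_inv_inverse[OF M] matrix_inv_inverse[of "matrix_inv M"]
      by (metis matrix_mul_assoc matrix_mul_lid matrix_mul_rid)
  qed
  then show ?thesis
    using invertible_matrix_inv by (force simp: orbit_def GL2_def act_eq_lin_subst)
qed

lemma orbit_eq_iff:
  fixes P P' :: "'a::field poly poly"
  shows "orbit GL2 act P = orbit GL2 act P' \<longleftrightarrow> (\<exists>M. invertible M \<and> P' = lin_subst M P)"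
proof
  assume "orbit GL2 act P = orbit GL2 act P'"
  moreover have "P' \<in> orbit GL2 act P'"
    unfolding orbit_GL2 using lin_subst_mat_1[of P'] by (force simp: invertible_def intro!: exI[of _ "mat 1"])
  ultimately show "\<exists>M. invertible M \<and> P' = lin_subst M P" by (auto simp: orbit_GL2)
next
  assume "\<exists>M. invertible M \<and> P' = lin_subst M P"
  then obtain M where M: "invertible M" "P' = lin_subst M P" by blast
  have "lin_subst N P' = lin_subst (M ** N) P" "lin_subst N P = lin_subst (matrix_inv M ** N) P'" for N
    using matrix_inv_inverse[OF M(1)] by (simp_all add: M(2) lin_subst_lin_subst matrix_mul_assoc)
  then show "orbit GL2 act P = orbit GL2 act P'"
    unfolding orbit_GL2 using M(1) invertible_matrix_inv[OF M(1)] invertible_mult by blast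
qed

section \<open>Coprime pairs of cubes of linear forms\<close>

lemma lin_form_smult: "lin_form (t *s p) = scale t (lin_form p)"
  by (simp add: lin_form_eq_poly scale_def)

lemma scale_scale: "scale a (scale b P) = scale (a * b) P"
  by (simp add: scale_def mult.commute)

lemma scale_1: "scale 1 P = P"
  by (simp add: scale_def flip: one_pCons)

lemma scale_power: "scale c P ^ n = scale (c ^ n) (P ^ n)"
  by (simp only: scale_def smult_power poly_const_pow)

lemma scale_cube_smult: "scale (t ^ 3 * m) (lin_form p ^ 3) = scale m (lin_form (t *s p) ^ 3)"
  by (simp only: lin_form_smult scale_power scale_scale mult.commute)

lemma proportional_if_br_eq_0:
  fixes p r :: "'a::field^2"
  assumes "br p r = 0" "p \<noteq> 0"
  obtains t where "r = t *s p"
proof (cases "p $ 1 = 0")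
  case True
  then have "p $ 2 \<noteq> 0" using assms(2) by (auto simp: vec_eq_iff forall_2)
  then have "r = (r $ 2 / p $ 2) *s p"
    using assms(1) True by (simp add: vec_eq_iff forall_2 br_def)
  then show ?thesis by (rule that)
next
  case False
  then have "r = (r $ 1 / p $ 1) *s p"
    using assms(1) by (simp add: vec_eq_iff forall_2 br_def field_simps)
  then show ?thesis by (rule that)
qed

lemma dvd_scale_iff: "(c::'a::field) \<noteq> 0 \<Longrightarrow> D dvd scale c P \<longleftrightarrow> D dvd P"
proof
  assume "c \<noteq> 0" "D dvd scale c P"
  then have "D dvd [:[:inverse c:]:] * scale c P" by (metis dvd_mult)
  then show "D dvd P"
    using \<open>c \<noteq> 0\<close> by (simp add: scale_scale scale_1 flip: scale_eq_mult del: mult_pCons_left)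
qed (simp add: scale_eq_mult dvd_mult del: mult_pCons_left)

lemma not_unit_lin_form: "\<not> is_unit (lin_form p)"
proof
  assume "is_unit (lin_form p)"
  then obtain w where "1 = lin_form p * w" by (auto simp: dvd_def)
  then have "eval_at 1 0 = eval_at (lin_form p) 0 * eval_at w 0"
    by (metis eval_at_simps(2))
  then show False by (simp add: eval_at_simps) (simp add: eval_at_def)
qed

text \<open>Dependent forms have a common linear factor. For independent forms, every fifth power of a linear
  form lies in the ideal generated by the two cubes, because each term of the binomial expansion contains
  one of them; so a common divisor divides \<open>x\<^sup>5\<close> and \<open>y\<^sup>5\<close> and is a unit.\<close>

lemma coprime_cubes_iff:
  fixes p r :: "'a::field^2"
  assumes "l \<noteq> 0" "m \<noteq> 0" "p \<noteq> 0"
  shows "coprime (scale l (lin_form p ^ 3)) (scale m (lin_form r ^ 3)) \<longleftrightarrow> br p r \<noteq> 0"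
proof
  assume cop: "coprime (scale l (lin_form p ^ 3)) (scale m (lin_form r ^ 3))"
  show "br p r \<noteq> 0"
  proof
    assume "br p r = 0"
    then obtain t where "r = t *s p" using assms(3) by (rule proportional_if_br_eq_0)
    then have "lin_form p dvd lin_form r"
      by (simp add: lin_form_smult scale_eq_mult del: mult_pCons_left)
    then have "lin_form p dvd lin_form r ^ 3" by (simp add: dvd_power_le[of _ _ 1 3, simplified])
    moreover have "lin_form p dvd lin_form p ^ 3" by (simp add: dvd_power)
    ultimately have "is_unit (lin_form p)"
      using cop assms by (auto simp: coprime_def dvd_scale_iff)
    then show False using not_unit_lin_form by blast
  qed
next
  assume br: "br p r \<noteq> 0"
  show "coprime (scale l (lin_form p ^ 3)) (scale m (lin_form r ^ 3))"
  proof (rule coprimeI)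
    fix c assume "c dvd scale l (lin_form p ^ 3)" "c dvd scale m (lin_form r ^ 3)"
    then have c: "c dvd lin_form p ^ 3" "c dvd lin_form r ^ 3"
      using assms by (simp_all add: dvd_scale_iff)
    have comb: "c dvd (e * lin_form p + f * lin_form r) ^ 5" for e f
    proof -
      \<comment> \<open>The exponent 5 is the least one for which one of the two factors must occur at least three times.\<close>
      have "(e * lin_form p + f * lin_form r) ^ 5
        = lin_form p ^ 3 * (e^5 * lin_form p ^ 2 + 5 * e^4 * f * lin_form p * lin_form r
              + 10 * e^3 * f^2 * lin_form r ^ 2)
        + lin_form r ^ 3 * (f^5 * lin_form r ^ 2 + 5 * e * f^4 * lin_form p * lin_form r
              + 10 * e^2 * f^3 * lin_form p ^ 2)"
        by algebra
      then show ?thesis using c by (metis dvd_add dvd_mult2)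
    qed
    have "scale (br p r) var_x = [:[:r $ 2:]:] * lin_form p + [:[:- p $ 2:]:] * lin_form r"
      "scale (br p r) var_y = [:[:- r $ 1:]:] * lin_form p + [:[:p $ 1:]:] * lin_form r"
      by (simp_all add: lin_form_eq_poly scale_def var_x_def var_y_def br_def algebra_simps)
    then have "c dvd (scale (br p r) var_x) ^ 5" "c dvd (scale (br p r) var_y) ^ 5"
      by (metis comb)+
    then have x: "c dvd var_x ^ 5" and y: "c dvd var_y ^ 5"
      using br by (simp_all add: dvd_scale_iff scale_power)
    \<comment> \<open>A divisor of \<open>x\<^sup>5\<close> does not involve \<open>y\<close>, so dividing \<open>y\<^sup>5\<close> means dividing its leading coefficient 1.\<close>
    have "var_x ^ 5 = [:[:0, 1::'a:] ^ 5:]" by (simp add: var_x_def poly_const_pow)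
    then have "degree c \<le> 0" using x by (metis dvd_imp_degree_le degree_pCons_0 pCons_eq_0_iff power_eq_0_iff one_neq_zero)
    then obtain u where u: "c = [:u:]" by (metis degree_eq_zeroE le_zero_eq)
    have "var_y ^ 5 = monom (1 :: 'a poly) 5" by (simp add: var_y_def monom_altdef)
    then have "u dvd 1"
      using y unfolding u const_poly_dvd_iff by (metis coeff_monom)
    then show "is_unit c" unfolding u by (simp add: is_unit_const_poly_iff)
  qed
qed

lemma lin_indep_pair_iff: "lin_indep_pair (lin_form p) (lin_form r) \<longleftrightarrow> br p (r::'a::field^2) \<noteq> 0"
proof
  assume li: "lin_indep_pair (lin_form p) (lin_form r)"
  show "br p r \<noteq> 0"
  proof
    assume br: "br p r = 0"
    show False
    proof (cases "p = 0")
      case True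
      then have "scale 1 (lin_form p) + scale 0 (lin_form r) = 0" by (simp add: lin_form_eq_poly scale_def)
      then show False using li unfolding lin_indep_pair_def by (metis one_neq_zero)
    next
      case False
      obtain t where "r = t *s p" using proportional_if_br_eq_0[OF br False] .
      then have "scale t (lin_form p) + scale (- 1) (lin_form r) = 0" by (simp add: lin_form_eq_poly scale_def)
      then show False using li unfolding lin_indep_pair_def by (metis neg_equal_0_iff_equal one_neq_zero)
    qed
  qed
next
  assume br: "br p r \<noteq> 0"
  show "lin_indep_pair (lin_form p) (lin_form r)"
    unfolding lin_indep_pair_def
  proof (intro allI impI)
    fix a b assume "scale a (lin_form p) + scale b (lin_form r) = 0"
    then have e: "a * p $ 1 + b * r $ 1 = 0" "a * p $ 2 + b * r $ 2 = 0"
      by (simp_all add: lin_form_eq_poly scale_def mult.commute)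
    have "a * br p r = 0" "b * br p r = 0" unfolding br_def using e by algebra+
    then show "a = 0 \<and> b = 0" using br by simp
  qed
qed

section \<open>Sums of two cubes\<close>

definition cube_sum :: "'a::field \<Rightarrow> 'a^2 \<Rightarrow> 'a \<Rightarrow> 'a^2 \<Rightarrow> 'a poly poly"
  where "cube_sum l p m r = scale l (lin_form p ^ 3) + scale m (lin_form r ^ 3)"

lemma cube_sum_swap: "cube_sum l p m r = cube_sum m r l p"
  by (simp add: cube_sum_def add.commute)

lemma cube_sum_in_cubics: "cube_sum l p m r \<in> cubics"
  by (auto simp: cube_sum_def cubics_def scale_cube_lin_form cubic_add)

lemma Qn_cube_sum:
  assumes "(2::'a::field) \<noteq> 0" "(3::'a) \<noteq> 0"
  shows "Qn (cube_sum l p m r) = (l * m * br p (r::'a^2) ^ 3)^2"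
proof -
  obtain a b c d where "cube_sum l p m r = cubic a b c d"
    using cube_sum_in_cubics by (force simp: cubics_def)
  then show ?thesis using Qn_sum_of_cubes[OF assms] by (metis cube_sum_def)
qed

text \<open>Both decompositions are instances of \<open>half_cubic\<close> at a square root of the same quartic invariant,
  and there are only the two roots \<open>N\<close> and \<open>- N\<close>.\<close>

lemma cube_sum_unique:
  fixes p r :: "'a::field^2"
  assumes ch: "(2::'a) \<noteq> 0" "(3::'a) \<noteq> 0"
    and eq: "cube_sum l p m r = cube_sum l' p' m' r'"
    and N: "N = l * m * br p r ^ 3" "N \<noteq> 0" and N': "N' = l' * m' * br p' r' ^ 3" "N' \<noteq> 0"
  shows "N' = N \<and> scale l' (lin_form p' ^ 3) = scale l (lin_form p ^ 3)
        \<and> scale m' (lin_form r' ^ 3) = scale m (lin_form r ^ 3)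
      \<or> N' = - N \<and> scale l' (lin_form p' ^ 3) = scale m (lin_form r ^ 3)
        \<and> scale m' (lin_form r' ^ 3) = scale l (lin_form p ^ 3)"
proof -
  obtain a b c d where P: "cubic a b c d = cube_sum l p m r"
    using cube_sum_in_cubics[of l p m r] by (force simp: cubics_def)
  have sw: "cubic a b c d = cube_sum m r l p" "cubic a b c d = cube_sum l' p' m' r'"
    "cubic a b c d = cube_sum m' r' l' p'"
    using P cube_sum_swap eq by metis+
  have neg: "m * l * br r p ^ 3 = - N" "m' * l' * br r' p' ^ 3 = - N'"
    unfolding N N' br_def by algebra+
  note hc = half_cubic_sum_of_cubes[OF ch, folded cube_sum_def]
  have h: "half_cubic N a b c d = scale l (lin_form p ^ 3)"
      "half_cubic (- N) a b c d = scale m (lin_form r ^ 3)"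
      "half_cubic N' a b c d = scale l' (lin_form p' ^ 3)"
      "half_cubic (- N') a b c d = scale m' (lin_form r' ^ 3)"
    using hc[OF P] hc[OF sw(1)] hc[OF sw(2)] hc[OF sw(3)] N N' neg by simp_all
  have "N'^2 = N^2"
    using Qn_cube_sum[OF ch] eq N N' by metis
  then have "N' = N \<or> N' = - N" by (simp add: power2_eq_iff)
  then show ?thesis using h by force
qed

text \<open>The two summands are \<open>half_cubic\<close> at the two square roots of the quartic invariant. That
  they are independent follows by comparing the quartic invariants of both sides.\<close>

lemma cubic_eq_cube_sum:
  assumes "(2::'a::field) \<noteq> 0" "(3::'a) \<noteq> 0" "Qn (cubic a b c d) = q^2" "(q::'a) \<noteq> 0"
  obtains l p m r where "half_cubic q a b c d = scale l (lin_form p ^ 3)"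
    "half_cubic (- q) a b c d = scale m (lin_form r ^ 3)"
    "cubic a b c d = cube_sum l p m r" "l * m * br p r ^ 3 \<noteq> 0"
proof -
  obtain l p where l: "half_cubic q a b c d = scale l (lin_form p ^ 3)"
    using half_cubic_cube[OF assms] by blast
  obtain m r where m: "half_cubic (- q) a b c d = scale m (lin_form r ^ 3)"
    using half_cubic_cube[of a b c d "- q"] assms by auto
  have s: "cubic a b c d = cube_sum l p m r"
    using half_cubic_add[OF assms(1), of q a b c d] by (simp add: cube_sum_def l m)
  then have "(l * m * br p r ^ 3)^2 = q^2"
    using Qn_cube_sum[OF assms(1,2)] assms(3) by metis
  then have "l * m * br p r ^ 3 \<noteq> 0" using assms(4) by (metis power_zero_numeral zero_eq_power2)
  then show ?thesis using that l m s by blast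
qed

lemma lin_subst_cube_sum: "lin_subst M (cube_sum l p m r) = cube_sum l (p v* M) m (r v* M)"
  by (simp add: cube_sum_def lin_subst_add lin_subst_cube)

lemma br_vector_matrix_mult: "br (p v* M) (r v* M) = br p r * det M"
  by (simp add: br_def vector_matrix_mult_def sum_2 det_2) algebra

text \<open>The matrix is the inverse of the one with rows \<open>p, r\<close> times the one with rows \<open>p', r'\<close>.\<close>

lemma br_transitive:
  fixes p r p' r' :: "'a::field^2"
  assumes "br p r \<noteq> 0" "br p' r' \<noteq> 0"
  obtains M where "invertible M" "p v* M = p'" "r v* M = r'"
proof
  define M :: "'a^2^2" where "M = (\<chi> i j. (if i = 1 then r $ 2 * p' $ j - p $ 2 * r' $ j
      else p $ 1 * r' $ j - r $ 1 * p' $ j) / br p r)"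
  have e: "x * (a / br p r) + y * (b / br p r) = c" if "x * a + y * b = br p r * c" for x y a b c
    using that assms(1) by (simp add: nonzero_divide_eq_eq mult.commute flip: add_divide_distrib)
  have M12: "M $ 1 $ j = (r $ 2 * p' $ j - p $ 2 * r' $ j) / br p r"
    "M $ 2 $ j = (p $ 1 * r' $ j - r $ 1 * p' $ j) / br p r" for j
    by (simp_all add: M_def)
  have "p $ 1 * M $ 1 $ j + p $ 2 * M $ 2 $ j = p' $ j" for j
    unfolding M12 by (rule e) (simp add: br_def algebra_simps)
  moreover have "r $ 1 * M $ 1 $ j + r $ 2 * M $ 2 $ j = r' $ j" for j
    unfolding M12 by (rule e) (simp add: br_def algebra_simps)
  ultimately show M: "p v* M = p'" "r v* M = r'"
    using assms(1) by (simp_all add: vec_eq_iff vector_matrix_mult_def sum_2 mult.commute)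
  show "invertible M"
    using br_vector_matrix_mult[of p M r] assms(2) by (auto simp: M invertible_det_nz)
qed

lemma br_smult: "br (s *s p) (t *s r) = s * t * br p r"
  by (simp add: br_def algebra_simps)

text \<open>The product of \<open>l m\<close> and \<open>l / m\<close> is \<open>l\<^sup>2\<close>, and a ratio whose square is a cube is itself a cube, since
  \<open>2\<close> and \<open>3\<close> are coprime exponents.\<close>

lemma ratio_is_cube:
  fixes l m l' m' :: "'a::field"
  assumes "l \<noteq> 0" "m \<noteq> 0" "l' \<noteq> 0" "m' \<noteq> 0"
    and "cube_class (l * m) = cube_class (l' * m')" "cube_class (l / m) = cube_class (l' / m')"
  obtains v where "v \<noteq> 0" "l = v ^ 3 * l'"
proof -
  obtain t u where t: "t \<noteq> 0" "l * m = t ^ 3 * (l' * m')" and u: "u \<noteq> 0" "l / m = u ^ 3 * (l' / m')"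
    using assms(5,6) unfolding cube_class_eq_iff by blast
  have u': "l * m' = u ^ 3 * l' * m" using u assms(2,4) by (simp add: field_simps)
  have "l ^ 2 * (m * m') = (t * u) ^ 3 * l' ^ 2 * (m * m')" using t(2) u' by algebra
  then have s: "l ^ 2 = (t * u) ^ 3 * l' ^ 2" using assms(2,4) by simp
  define v where "v = l / (t * u * l')"
  have "v \<noteq> 0" "l = v * (t * u * l')" using assms(1,3) t(1) u(1) by (simp_all add: v_def)
  then have "(v ^ 3 * l') * ((t * u) ^ 3 * l' ^ 2) = l * ((t * u) ^ 3 * l' ^ 2)"
    using s by algebra
  then have "v ^ 3 * l' = l" using assms(3) t(1) u(1) by simp
  then show ?thesis using that \<open>v \<noteq> 0\<close> by metis
qed

section \<open>The split case\<close>

text \<open>Comparing the coefficient at a coordinate where the form does not vanish shows that any two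
  representations differ by the cube of a ratio of coordinates.\<close>

lemma I_T_cube:
  fixes p :: "'a::field^2"
  assumes "(3::'a) \<noteq> 0" "l \<noteq> 0" "p \<noteq> 0"
  shows "I_T (scale l (lin_form p ^ 3)) = cube_class l"
proof -
  have eq: "cube_class l' = cube_class l"
    if "l' \<noteq> 0" "p' \<noteq> 0" and e: "scale l (lin_form p ^ 3) = scale l' (lin_form p' ^ 3)" for l' and p' :: "'a^2"
  proof -
    have c: "l * (p $ i) ^ 3 = l' * (p' $ i) ^ 3" for i
      using e exhaust_2[of i] unfolding scale_cube_lin_form cubic_inject[OF assms(1)] by auto
    obtain i where "p $ i \<noteq> 0" using assms(3) by (auto simp: vec_eq_iff)
    then have "p' $ i \<noteq> 0" using c[of i] assms(2) by auto
    have "l' = (p $ i / p' $ i) ^ 3 * l"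
      using c[of i] \<open>p' $ i \<noteq> 0\<close> by (simp add: power_divide eq_divide_eq mult.commute)
    then show ?thesis
      unfolding cube_class_eq_iff using \<open>p $ i \<noteq> 0\<close> \<open>p' $ i \<noteq> 0\<close> by (metis divide_eq_0_iff)
  qed
  have "{cube_class l' | l' p'. l' \<noteq> 0 \<and> p' \<noteq> 0 \<and> scale l (lin_form p ^ 3) = scale l' (lin_form p' ^ 3)}
      = {cube_class l}"
    using eq assms by blast
  then show ?thesis by (simp add: I_T_def)
qed

lemma prod_rel_class:
  assumes "x \<noteq> 0" "(a::'a::field) \<noteq> 0"
  shows "prod_rel `` {(x, cube_class a)} = {(x, cube_class a), (- x, cube_class (inverse a))}"
  using assms unfolding prod_rel_def
  by (subst Z2_rel_class) (auto simp: neg_inv_def cube_class_inv cube_class_in_carrier)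

lemma inv_rel_class:
  assumes "(a::'a::field) \<noteq> 0"
  shows "inv_rel `` {cube_class a} = {cube_class a, cube_class (inverse a)}"
  using assms unfolding inv_rel_def
  by (subst Z2_rel_class) (auto simp: cube_class_inv cube_class_in_carrier)

text \<open>The value is computed from an arbitrary decomposition. Exchanging the two summands changes the sign
  of the symplectic product and inverts the ratio, so it stays in the same \<open>Z_2\<close>-orbit; and the projection
  is constant on this orbit since \<open>- 1\<close> is a cube. The symplectic product itself has the cube class of
  \<open>l m\<close>, the determinant contributing only a cube.\<close>

lemma J_O1_cube_sum:
  fixes p r :: "'a::field^2"
  assumes ch: "(2::'a) \<noteq> 0" "(3::'a) \<noteq> 0" and nz: "l * m * br p r ^ 3 \<noteq> 0"
  shows "J_O1 (cube_sum l p m r) = (cube_class (l * m), {cube_class (l / m), cube_class (m / l)})"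
proof -
  define N where "N = l * m * br p r ^ 3"
  define T1 T2 where "T1 = scale l (lin_form p ^ 3)" and "T2 = scale m (lin_form r ^ 3)"
  define C :: "('a \<times> 'a set) set" where "C = {(N, cube_class (l / m)), (- N, cube_class (m / l))}"
  define val :: "'a poly poly \<Rightarrow> 'a poly poly \<Rightarrow> ('a \<times> 'a set) set"
    where "val = (\<lambda>T1 T2. prod_rel ``
      {(omega T1 T2, I_T T1 \<otimes>\<^bsub>cube_classes\<^esub> inv\<^bsub>cube_classes\<^esub> (I_T T2))})"
  have lm: "l \<noteq> 0" "m \<noteq> 0" "br p r \<noteq> 0" and "N \<noteq> 0" using nz by (auto simp: N_def)
  have pr: "p \<noteq> 0" "r \<noteq> 0" using lm(3) by (auto simp: br_def)
  have om: "omega T1 T2 = N" "omega T2 T1 = - N"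
    unfolding T1_def T2_def omega_cubes[OF ch(2)] N_def br_def by algebra+
  have val: "val T1 T2 = C" "val T2 T1 = C"
    unfolding val_def om C_def
    using lm pr \<open>N \<noteq> 0\<close>
    by (auto simp: T1_def T2_def I_T_cube[OF ch(2)] cube_class_inv cube_class_mult prod_rel_class
        divide_inverse mult.commute)
  have "val T1' T2' = C"
    if T: "T1' \<in> T_set" "T2' \<in> T_set" "coprime T1' T2'" "cube_sum l p m r = T1' + T2'" for T1' T2'
  proof -
    obtain l' p' where T1': "T1' = scale l' (lin_form p' ^ 3)" "l' \<noteq> 0" "p' \<noteq> 0"
      using T(1) by (auto simp: T_set_def)
    obtain m' r' where T2': "T2' = scale m' (lin_form r' ^ 3)" "m' \<noteq> 0" "r' \<noteq> 0"
      using T(2) by (auto simp: T_set_def)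
    have "l' * m' * br p' r' ^ 3 \<noteq> 0"
      using T(3) T1' T2' coprime_cubes_iff[of l' m' p' r'] by simp
    moreover have "cube_sum l p m r = cube_sum l' p' m' r'"
      using T(4) by (simp add: T1'(1) T2'(1) cube_sum_def)
    ultimately have "T1' = T1 \<and> T2' = T2 \<or> T1' = T2 \<and> T2' = T1"
      using cube_sum_unique[OF ch _ refl _ refl] nz by (metis T1'(1) T2'(1) T1_def T2_def)
    then show ?thesis using val by auto
  qed
  moreover have "T1 \<in> T_set" "T2 \<in> T_set" "coprime T1 T2" "cube_sum l p m r = T1 + T2"
    using lm pr coprime_cubes_iff[of l m p r] by (auto simp: T1_def T2_def T_set_def cube_sum_def)
  ultimately have "{val T1' T2' | T1' T2'. T1' \<in> T_set \<and> T2' \<in> T_set \<and> coprime T1' T2'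
      \<and> cube_sum l p m r = T1' + T2'} = {C}"
    using val by blast
  then have "I_O1 (cube_sum l p m r) = C"
    by (simp add: I_O1_def val_def)
  moreover have "cube_class N = cube_class (l * m)"
    unfolding N_def using lm by (simp add: cube_class_times_cube)
  ultimately show ?thesis
    using lm inv_rel_class[of "l / m"] inv_rel_class[of "m / l"]
    by (simp add: J_O1_def proj_pi_def C_def cube_class_uminus insert_commute)
qed

text \<open>The coefficients of the two sums agree up to cubes. These are moved into the linear forms, after
  which a single matrix carries one pair of forms to the other.\<close>

lemma orbit_eq_if_cube_classes_eq:
  fixes p r p' r' :: "'a::field^2"
  assumes nz: "l * m * br p r ^ 3 \<noteq> 0" "l' * m' * br p' r' ^ 3 \<noteq> 0"
    and cl: "cube_class (l * m) = cube_class (l' * m')" "cube_class (l / m) = cube_class (l' / m')"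
  shows "orbit GL2 act (cube_sum l p m r) = orbit GL2 act (cube_sum l' p' m' r')"
proof -
  have nz': "l \<noteq> 0" "m \<noteq> 0" "br p r \<noteq> 0" "l' \<noteq> 0" "m' \<noteq> 0" "br p' r' \<noteq> 0" using nz by auto
  obtain v where v: "v \<noteq> 0" "l = v ^ 3 * l'"
    using ratio_is_cube[OF nz'(1,2,4,5) cl] .
  have cl': "cube_class (m * l) = cube_class (m' * l')" using cl(1) by (simp add: mult.commute)
  have "cube_class (m / l) = cube_class (m' / l')"
    using cl(2) cube_class_inv[of "l / m"] cube_class_inv[of "l' / m'"] nz' by simp
  then obtain w where w: "w \<noteq> 0" "m = w ^ 3 * m'"
    using ratio_is_cube[OF nz'(2,1,5,4) cl'] by blast
  have "cube_sum l p m r = cube_sum l' (v *s p) m' (w *s r)"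
    by (simp only: cube_sum_def v(2) w(2) scale_cube_smult)
  moreover have "br (v *s p) (w *s r) \<noteq> 0" using nz' v w by (simp add: br_smult)
  then obtain M where "invertible M" "(v *s p) v* M = p'" "(w *s r) v* M = r'"
    using br_transitive[OF _ nz'(6)] by blast
  ultimately show ?thesis
    unfolding orbit_eq_iff by (metis lin_subst_cube_sum)
qed

lemma O1_eq_cube_sums:
  assumes "(2::'a::field) \<noteq> 0" "(3::'a) \<noteq> 0"
  shows "O1 = {cube_sum l p m r | l m p r. l * m * br p (r::'a^2) ^ 3 \<noteq> 0}"
proof (intro equalityI subsetI)
  fix P :: "'a poly poly" assume P: "P \<in> O1"
  then obtain a b c d where abcd: "P = cubic a b c d" unfolding O1_def cubics_def by blast
  obtain q where "Qn (cubic a b c d) = q ^ 2" "q \<noteq> 0" using P unfolding O1_def abcd by blast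
  then obtain l p m r where "cubic a b c d = cube_sum l p m r" "l * m * br p r ^ 3 \<noteq> 0"
    by (rule cubic_eq_cube_sum[OF assms])
  then show "P \<in> {cube_sum l p m r | l m p r. l * m * br p r ^ 3 \<noteq> 0}"
    unfolding abcd by blast
next
  fix P :: "'a poly poly" assume "P \<in> {cube_sum l p m r | l m p r. l * m * br p r ^ 3 \<noteq> 0}"
  then obtain l m p and r :: "'a^2" where P: "P = cube_sum l p m r" and N: "l * m * br p r ^ 3 \<noteq> 0" by blast
  have "Qn P \<in> {q ^ 2 | q. q \<noteq> 0}" unfolding P Qn_cube_sum[OF assms] using N by blast
  then show "P \<in> O1" unfolding O1_def using P cube_sum_in_cubics by blast
qed

text \<open>A substitution leaves the two coefficients of a sum of cubes unchanged, hence the invariant. In the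
  converse direction the second class is known only up to inversion; the inverted case is reduced to
  the other one by exchanging the summands of one of the cubics.\<close>

lemma J_O1_separates_orbits:
  fixes P P' :: "'a::field poly poly"
  assumes ch: "(2::'a) \<noteq> 0" "(3::'a) \<noteq> 0" and "P \<in> O1" "P' \<in> O1"
  shows "orbit GL2 act P = orbit GL2 act P' \<longleftrightarrow> J_O1 P = J_O1 P'"
proof -
  obtain l m p and r :: "'a^2" where P: "P = cube_sum l p m r" and N: "l * m * br p r ^ 3 \<noteq> 0"
    using assms(3) O1_eq_cube_sums[OF ch] by blast
  obtain l' m' p' and r' :: "'a^2" where P': "P' = cube_sum l' p' m' r'" and N': "l' * m' * br p' r' ^ 3 \<noteq> 0"
    using assms(4) O1_eq_cube_sums[OF ch] by blast
  show ?thesis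
  proof
    assume "orbit GL2 act P = orbit GL2 act P'"
    then obtain M where M: "invertible M" "P' = lin_subst M P" by (auto simp: orbit_eq_iff)
    have N'': "l * m * br (p v* M) (r v* M) ^ 3 \<noteq> 0"
      using N M(1) by (simp add: br_vector_matrix_mult invertible_det_nz)
    show "J_O1 P = J_O1 P'"
      by (simp only: M(2) P lin_subst_cube_sum J_O1_cube_sum[OF ch N] J_O1_cube_sum[OF ch N''])
  next
    assume "J_O1 P = J_O1 P'"
    then have cl: "cube_class (l * m) = cube_class (l' * m')"
      and alt: "cube_class (l / m) = cube_class (l' / m') \<or> cube_class (l / m) = cube_class (m' / l')"
      unfolding P P' J_O1_cube_sum[OF ch N] J_O1_cube_sum[OF ch N'] by (auto simp: doubleton_eq_iff)
    from alt show "orbit GL2 act P = orbit GL2 act P'"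
    proof
      assume "cube_class (l / m) = cube_class (l' / m')"
      then show ?thesis unfolding P P' by (rule orbit_eq_if_cube_classes_eq[OF N N' cl])
    next
      assume *: "cube_class (l / m) = cube_class (m' / l')"
      have N'': "m' * l' * br r' p' ^ 3 \<noteq> 0" using N' by (auto simp: br_swap[of r' p'])
      have cl': "cube_class (l * m) = cube_class (m' * l')" using cl by (simp add: mult.commute)
      show ?thesis unfolding P P' cube_sum_swap[of l']
        by (rule orbit_eq_if_cube_classes_eq[OF N N'' cl' *])
    qed
  qed
qed

lemma J_O1_image:
  assumes ch: "(2::'a::field) \<noteq> 0" "(3::'a) \<noteq> 0"
  shows "J_O1 ` (O1 :: 'a poly poly set) = J_target"
proof (intro equalityI subsetI)
  fix z :: "'a set \<times> 'a set set" assume "z \<in> J_O1 ` O1"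
  then obtain l m p and r :: "'a^2" where z: "z = J_O1 (cube_sum l p m r)" and N: "l * m * br p r ^ 3 \<noteq> 0"
    unfolding O1_eq_cube_sums[OF ch] by blast
  have "z = (cube_class (l * m), inv_rel `` {cube_class (l / m)})"
    using N inv_rel_class[of "l / m"] by (simp add: z J_O1_cube_sum[OF ch N])
  then show "z \<in> J_target"
    using N by (auto simp: J_target_def intro!: quotientI cube_class_in_carrier)
next
  fix z :: "'a set \<times> 'a set set" assume "z \<in> J_target"
  then obtain a b where ab: "a \<noteq> 0" "b \<noteq> 0" and z: "z = (cube_class a, inv_rel `` {cube_class b})"
    by (auto simp: J_target_def quotient_def carrier_cube_classes)
  \<comment> \<open>The equations \<open>[l m] = [a]\<close> and \<open>[l / m] = [b]\<close> force \<open>[l]\<^sup>2 = [a b]\<close>, that is \<open>[l] = [a b]\<^sup>-\<^sup>1\<close> as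
    cubes are trivial.\<close>
  define l m where "l = inverse (a * b)" and "m = inverse (a * b) / b"
  define p r :: "'a^2" where "p = vector [1, 0]" and "r = vector [0, 1]"
  have N: "l * m * br p r ^ 3 \<noteq> 0" using ab by (simp add: l_def m_def p_def r_def br_def)
  have "l / m = b" "m / l = inverse b" using ab by (simp_all add: l_def m_def field_simps)
  moreover have "l * m = a * (inverse (a * b)) ^ 3"
    using ab by (simp add: l_def m_def power3_eq_cube divide_inverse)
  then have "cube_class (l * m) = cube_class a"
    using ab by (simp only: cube_class_times_cube inverse_nonzero_iff_nonzero mult_eq_0_iff simp_thms)
  ultimately have "z = J_O1 (cube_sum l p m r)"
    unfolding J_O1_cube_sum[OF ch N] z using ab by (simp add: inv_rel_class)
  moreover have "cube_sum l p m r \<in> O1" unfolding O1_eq_cube_sums[OF ch] using N by blast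
  ultimately show "z \<in> J_O1 ` O1" by blast
qed

section \<open>Extension of scalars\<close>

lemma
  fixes f :: "'a::field \<Rightarrow> 'b::field"
  assumes "field_hom f"
  shows field_hom_1: "f 1 = 1" and field_hom_add: "f (x + y) = f x + f y"
    and field_hom_mult: "f (x * y) = f x * f y" and field_hom_0: "f 0 = 0"
    and field_hom_uminus: "f (- x) = - f x" and field_hom_diff: "f (x - y) = f x - f y"
    and field_hom_power: "f (x ^ n) = f x ^ n" and field_hom_eq_0_iff: "f x = 0 \<longleftrightarrow> x = 0"
    and field_hom_inverse: "f (inverse x) = inverse (f x)" and field_hom_divide: "f (x / y) = f x / f y"
    and field_hom_inj: "inj f" and field_hom_numeral: "f (numeral w) = numeral w"
proof -
  show 1: "f 1 = 1" and a: "f (x + y) = f x + f y" and m: "f (x * y) = f x * f y" for x y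
    using assms by (auto simp: field_hom_def)
  show 0: "f 0 = 0" using a[of 0 0] unfolding add_0 by (rule add_cancel_right_right[THEN iffD1])
  show u: "f (- x) = - f x" for x using a[of x "- x"] 0 by (simp add: eq_neg_iff_add_eq_0 add.commute)
  show d: "f (x - y) = f x - f y" for x y using a[of x "- y"] u[of y] by simp
  show "f (x ^ n) = f x ^ n" by (induction n) (simp_all add: 1 m)
  have nz: "f x \<noteq> 0" if "x \<noteq> 0" for x
    using m[of x "inverse x"] 1 that by auto
  then show "f x = 0 \<longleftrightarrow> x = 0" using 0 by blast
  show i: "f (inverse x) = inverse (f x)" for x
  proof (cases "x = 0")
    case False
    then have "f x * f (inverse x) = 1" using m[of x "inverse x"] 1 by simp
    then show ?thesis by (metis inverse_unique)
  qed (simp add: 0)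
  show "f (x / y) = f x / f y" using m[of x "inverse y"] i[of y] by (simp add: divide_inverse)
  show "inj f"
  proof (rule injI)
    fix x y assume "f x = f y"
    then have "f (x - y) = 0" using d[of x y] by simp
    then show "x = y" using nz[of "x - y"] by auto
  qed
  have "f (of_nat n) = of_nat n" for n by (induction n) (simp_all add: 0 1 a)
  from this[of "numeral w"] show "f (numeral w) = numeral w" by simp
qed

lemmas field_hom_simps = field_hom_1 field_hom_add field_hom_mult field_hom_0 field_hom_uminus
  field_hom_diff field_hom_power field_hom_eq_0_iff field_hom_inverse field_hom_divide field_hom_numeral

definition map_coeffs :: "('a::field \<Rightarrow> 'b::field) \<Rightarrow> 'a poly poly \<Rightarrow> 'b poly poly"
  where "map_coeffs f = map_poly (map_poly f)"

definition map_vec :: "('a \<Rightarrow> 'b) \<Rightarrow> 'a ^ 'n \<Rightarrow> 'b ^ 'n"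
  where "map_vec f p = (\<chi> i. f (p $ i))"

lemma map_vec_nth [simp]: "map_vec f p $ i = f (p $ i)"
  by (simp add: map_vec_def)

context
  fixes f :: "'a::field \<Rightarrow> 'b::field"
  assumes f: "field_hom f"
begin

lemma map_coeffs_add: "map_coeffs f (P + Q) = map_coeffs f P + map_coeffs f Q"
  by (simp add: map_coeffs_def map_poly_add_hom field_hom_simps[OF f])

lemma map_coeffs_mult: "map_coeffs f (P * Q) = map_coeffs f P * map_coeffs f Q"
  by (simp add: map_coeffs_def map_poly_add_hom map_poly_mult_hom field_hom_simps[OF f])

lemma map_coeffs_const: "map_coeffs f [:[:c:]:] = [:[:f c:]:]"
  by (simp add: map_coeffs_def map_poly_pCons field_hom_simps[OF f])

lemma map_coeffs_scale: "map_coeffs f (scale c P) = scale (f c) (map_coeffs f P)"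
  unfolding scale_eq_mult map_coeffs_mult map_coeffs_const ..

lemma map_coeffs_cubic: "map_coeffs f (cubic a b c d) = cubic (f a) (f b) (f c) (f d)"
  by (simp add: map_coeffs_def cubic_eq_poly map_poly_pCons field_hom_simps[OF f])

lemma map_coeffs_lin_form: "map_coeffs f (lin_form p) = lin_form (map_vec f p)"
  by (simp add: map_coeffs_def lin_form_eq_poly map_poly_pCons field_hom_simps[OF f])

lemma map_coeffs_power: "map_coeffs f (P ^ n) = map_coeffs f P ^ n"
  by (induction n) (simp_all add: map_coeffs_mult, simp add: map_coeffs_def one_pCons map_poly_pCons field_hom_simps[OF f])

lemma map_coeffs_cube:
  "map_coeffs f (scale m (lin_form p ^ 3)) = scale (f m) (lin_form (map_vec f p) ^ 3)"
  by (simp only: map_coeffs_scale map_coeffs_power map_coeffs_lin_form)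

lemma map_coeffs_cube_sum:
  "map_coeffs f (cube_sum l p m r) = cube_sum (f l) (map_vec f p) (f m) (map_vec f r)"
  by (simp only: cube_sum_def map_coeffs_add map_coeffs_cube)

lemma map_coeffs_half_cubic:
  "map_coeffs f (half_cubic q a b c d) = half_cubic (f q) (f a) (f b) (f c) (f d)"
  by (simp only: half_cubic_def map_coeffs_cubic field_hom_simps[OF f])

lemma map_coeffs_lin_subst:
  "map_coeffs f (lin_subst M P) = lin_subst (map_vec (map_vec f) M) (map_coeffs f P)"
proof (induction P rule: poly_poly_induct)
  case (add P Q)
  then show ?case by (simp add: lin_subst_add map_coeffs_add)
next
  case (const c)
  show ?case by (simp add: lin_subst_def subst_xy_simps map_coeffs_const)
next
  case (var_x P)
  have "map_coeffs f var_x = var_x" by (simp add: map_coeffs_def var_x_def map_poly_pCons field_hom_simps[OF f])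
  then show ?case using var_x by (simp add: lin_subst_mult map_coeffs_mult lin_subst_var map_coeffs_lin_form)
next
  case (var_y P)
  have "map_coeffs f var_y = var_y"
    by (simp add: map_coeffs_def var_y_def map_poly_pCons one_pCons field_hom_simps[OF f])
  then show ?case using var_y by (simp add: lin_subst_mult map_coeffs_mult lin_subst_var map_coeffs_lin_form)
qed

lemma map_coeffs_inject: "map_coeffs f P = map_coeffs f Q \<longleftrightarrow> P = Q"
proof
  have co: "coeff (coeff (map_coeffs f R) j) i = f (coeff (coeff R j) i)" for R i j
    by (simp add: map_coeffs_def coeff_map_poly field_hom_0[OF f])
  assume "map_coeffs f P = map_coeffs f Q"
  then have "f (coeff (coeff P j) i) = f (coeff (coeff Q j) i)" for i j
    by (simp only: co[symmetric])
  then show "P = Q" using injD[OF field_hom_inj[OF f]] by (intro poly_eqI) blast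
qed simp

lemma map_vec_vector_matrix_mult:
  fixes p :: "'a^2"
  shows "map_vec f (p v* M) = map_vec f p v* map_vec (map_vec f) M"
  by (simp add: vec_eq_iff vector_matrix_mult_def sum_2 field_hom_simps[OF f])

lemma br_map_vec: "br (map_vec f p) (map_vec f r) = f (br p r)"
  by (simp add: br_def field_hom_simps[OF f])

lemma det_map_vec: "det (map_vec (map_vec f) (M::'a^2^2)) = f (det M)"
  by (simp add: det_2 field_hom_simps[OF f])

end

section \<open>Quadratic extensions\<close>

text \<open>Away from characteristic 2 a quadratic extension is obtained by adjoining a square root \<open>s\<close> of some
  \<open>\<delta>\<close>. Fixing it makes the conjugation explicit and turns the imaginary elements into the multiples of \<open>s\<close>.\<close>

locale quadratic_generator =
  fixes \<iota> :: "'k::field \<Rightarrow> 'K::field" and s :: 'K and \<delta> :: 'k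
  assumes hom: "field_hom \<iota>" and char2: "(2 :: 'k) \<noteq> 0"
    and s_sq: "s ^ 2 = \<iota> \<delta>" and s_notin: "s \<notin> range \<iota>"
    and spans: "\<And>z. \<exists>a b. z = \<iota> a + \<iota> b * s"

text \<open>Any \<open>w\<close> outside the ground field forms a basis together with 1, by counting dimensions, and completing
  the square in its quadratic equation gives the generator.\<close>

lemma quadratic_extension_generator:
  fixes \<iota> :: "'k::field \<Rightarrow> 'K::field"
  assumes "(2::'k) \<noteq> 0" "quadratic_extension \<iota>"
  obtains s \<delta> where "quadratic_generator \<iota> s \<delta>"
proof -
  have hom: "field_hom \<iota>" and dim: "vector_space.dim (\<lambda>c z. \<iota> c * z) (UNIV :: 'K set) = 2"
    using assms(2) by (auto simp: quadratic_extension_def)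
  interpret vs: vector_space "\<lambda>c z. \<iota> c * z"
    by unfold_locales (simp_all add: field_hom_simps[OF hom] algebra_simps)
  obtain B where B: "vs.independent B" "UNIV \<subseteq> vs.span B" "card B = 2"
    using vs.basis_exists[of UNIV] dim by metis
  then have "finite B" by (metis card.infinite zero_neq_numeral)
  interpret fd: finite_dimensional_vector_space "\<lambda>c z. \<iota> c * z" B
    using B \<open>finite B\<close> by unfold_locales auto
  have "\<exists>w. w \<notin> range \<iota>"
  proof (rule ccontr)
    assume "\<nexists>w. w \<notin> range \<iota>"
    then have "UNIV \<subseteq> vs.span {1}" by (auto simp: vs.span_singleton)
    then have "vs.dim (UNIV :: 'K set) \<le> card {1 :: 'K}" by (intro vs.dim_le_card) auto
    then show False using dim by simp
  qed
  then obtain w where w: "w \<notin> range \<iota>" by blast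
  have "w \<noteq> 1" using w field_hom_1[OF hom] by (metis rangeI)
  have "vs.independent {1, w}"
  proof -
    have "w \<notin> vs.span {1}" using w by (auto simp: vs.span_singleton)
    then have "vs.independent {w, 1}" using vs.independent_insertI[of w "{1}"] by (simp add: vs.dependent_single)
    then show ?thesis by (simp add: insert_commute)
  qed
  then have "UNIV \<subseteq> vs.span {1, w}"
    using fd.card_eq_dim[of "{1, w}" UNIV] dim \<open>w \<noteq> 1\<close> by simp
  then have sp: "\<exists>a b. z = \<iota> a + \<iota> b * w" for z
    by (auto simp: vs.span_insert vs.span_singleton image_iff diff_eq_eq add.commute) 
  obtain a b where ab: "w ^ 2 = \<iota> a + \<iota> b * w" using sp by blast
  define s where "s = w - \<iota> (b / 2)"
  have two: "2 * \<iota> (b / 2) = \<iota> b"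
    using field_hom_mult[OF hom, of 2 "b / 2"] field_hom_numeral[OF hom] assms(1) by simp
  have "quadratic_generator \<iota> s (a + (b / 2) ^ 2)"
  proof (unfold_locales)
    show "s ^ 2 = \<iota> (a + (b / 2) ^ 2)"
      unfolding s_def field_hom_add[OF hom] field_hom_power[OF hom] using ab two by algebra
    show "s \<notin> range \<iota>"
    proof
      assume "s \<in> range \<iota>"
      then obtain c where "w = \<iota> (c + b / 2)" by (auto simp: s_def field_hom_add[OF hom] diff_eq_eq)
      then show False using w by blast
    qed
    show "\<exists>c d. z = \<iota> c + \<iota> d * s" for z
    proof -
      obtain c d where "z = \<iota> c + \<iota> d * w" using sp by blast
      then have "z = \<iota> (c + d * (b / 2)) + \<iota> d * s"
        unfolding s_def field_hom_add[OF hom] field_hom_mult[OF hom] by algebra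
      then show ?thesis by blast
    qed
  qed (use hom assms in auto)
  then show ?thesis by (rule that)
qed

context quadratic_generator
begin

lemmas \<iota>_simps = field_hom_simps[OF hom]

abbreviation conj :: "'K \<Rightarrow> 'K" where "conj \<equiv> conj_K \<iota>"

lemma two_neq_0: "(2 :: 'K) \<noteq> 0"
  using char2 field_hom_eq_0_iff[OF hom, of 2] by (simp add: field_hom_numeral[OF hom])

lemma s_neq_0: "s \<noteq> 0"
  using s_notin field_hom_0[OF hom] by (metis rangeI)

lemma coords_inject: "\<iota> a + \<iota> b * s = \<iota> a' + \<iota> b' * s \<longleftrightarrow> a = a' \<and> b = b'"
proof
  assume eq: "\<iota> a + \<iota> b * s = \<iota> a' + \<iota> b' * s"
  have "b = b'"
  proof (rule ccontr)
    assume "b \<noteq> b'"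
    then have "\<iota> (b - b') \<noteq> 0" using field_hom_eq_0_iff[OF hom, of "b - b'"] by simp
    moreover have "\<iota> (b - b') * s = \<iota> (a' - a)" using eq by (simp add: \<iota>_simps algebra_simps)
    ultimately have "s = \<iota> ((a' - a) / (b - b'))" by (simp add: field_hom_divide[OF hom] eq_divide_eq mult.commute)
    then show False using s_notin by blast
  qed
  then show "a = a' \<and> b = b'" using eq field_hom_inj[OF hom] by (auto dest: injD)
qed simp

text \<open>Replacing \<open>s\<close> by \<open>- s\<close> is an automorphism. It is the only nontrivial one, because
  an automorphism over the ground field must send \<open>s\<close> to a square root of \<open>\<delta>\<close>.\<close>

lemma conj_in_Gal: "conj \<in> Gal \<iota> \<and> conj s = - s"
proof -
  \<comment> \<open>The choice of coordinates is harmless, as they are unique.\<close>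
  define \<tau> where "\<tau> z = (let (a, b) = (SOME (a, b). z = \<iota> a + \<iota> b * s) in \<iota> a - \<iota> b * s)" for z
  have \<tau>: "\<tau> (\<iota> a + \<iota> b * s) = \<iota> a - \<iota> b * s" for a b
    unfolding \<tau>_def by (simp add: coords_inject)
  have "\<tau> \<in> Gal \<iota>"
    unfolding Gal_def field_hom_def
  proof (intro CollectI conjI allI)
    show \<tau>\<iota>: "\<tau> (\<iota> c) = \<iota> c" for c using \<tau>[of c 0] by (simp add: \<iota>_simps)
    show "\<tau> 1 = 1" using \<tau>\<iota>[of 1] by (simp add: \<iota>_simps)
    show "\<tau> (z + w) = \<tau> z + \<tau> w" for z w
    proof -
      obtain a b c d where "z = \<iota> a + \<iota> b * s" "w = \<iota> c + \<iota> d * s" using spans by (metis (no_types))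
      moreover from this have "z + w = \<iota> (a + c) + \<iota> (b + d) * s" by (simp add: \<iota>_simps algebra_simps)
      ultimately show ?thesis by (simp only: \<tau>) (simp add: \<iota>_simps algebra_simps)
    qed
    show "\<tau> (z * w) = \<tau> z * \<tau> w" for z w
    proof -
      obtain a b c d where zw: "z = \<iota> a + \<iota> b * s" "w = \<iota> c + \<iota> d * s" using spans by metis
      have ss: "\<iota> b * s * (\<iota> d * s) = \<iota> (b * d * \<delta>)"
        by (simp only: \<iota>_simps s_sq[symmetric] power2_eq_square mult_ac)
      have "z * w = \<iota> a * \<iota> c + (\<iota> a * \<iota> d + \<iota> b * \<iota> c) * s + \<iota> b * s * (\<iota> d * s)"
        by (simp add: zw algebra_simps)
      also have "\<dots> = \<iota> (a * c + b * d * \<delta>) + \<iota> (a * d + b * c) * s"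
        unfolding ss by (simp add: \<iota>_simps)
      finally have "\<tau> (z * w) = \<iota> (a * c + b * d * \<delta>) - \<iota> (a * d + b * c) * s" by (simp only: \<tau>)
      also have "\<dots> = \<iota> a * \<iota> c - (\<iota> a * \<iota> d + \<iota> b * \<iota> c) * s + \<iota> b * s * (\<iota> d * s)"
        unfolding ss by (simp add: \<iota>_simps)
      also have "\<dots> = (\<iota> a - \<iota> b * s) * (\<iota> c - \<iota> d * s)"
        by (simp add: algebra_simps)
      finally show ?thesis by (simp only: zw \<tau>)
    qed
    have "\<tau> (\<tau> z) = z" for z
    proof -
      obtain a b where z: "z = \<iota> a + \<iota> b * s" using spans by metis
      then have "\<tau> z = \<iota> a + \<iota> (- b) * s" by (simp only: \<tau>) (simp add: \<iota>_simps)
      then show ?thesis by (simp only: \<tau> z) (simp add: \<iota>_simps)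
    qed
    then show "bij \<tau>" by (intro o_bij[of \<tau>]) auto
  qed
  moreover have "\<tau> s = - s" using \<tau>[of 0 1] by (simp add: \<iota>_simps)
  moreover have "- s \<noteq> s"
  proof
    assume "- s = s"
    then have "2 * s = 0" by (metis mult_2 add.right_inverse)
    then show False using two_neq_0 s_neq_0 by simp
  qed
  moreover have "\<sigma> = \<tau>" if \<sigma>: "\<sigma> \<in> Gal \<iota>" "\<sigma> \<noteq> id" for \<sigma>
  proof -
    have h: "field_hom \<sigma>" and fixed: "\<sigma> (\<iota> c) = \<iota> c" for c using \<sigma>(1) by (auto simp: Gal_def)
    have \<sigma>z: "\<sigma> (\<iota> a + \<iota> b * s) = \<iota> a + \<iota> b * \<sigma> s" for a b
      by (simp add: field_hom_simps[OF h] fixed)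
    have "\<sigma> s ^ 2 = s ^ 2" using field_hom_power[OF h, of s 2] fixed s_sq by metis
    then have "\<sigma> s = s \<or> \<sigma> s = - s" by (simp add: power2_eq_iff)
    moreover have "\<sigma> s \<noteq> s"
    proof
      assume "\<sigma> s = s"
      then have "\<sigma> z = z" for z using spans[of z] \<sigma>z by auto
      then show False using \<sigma>(2) by auto
    qed
    ultimately have "\<sigma> s = - s" by blast
    then have "\<sigma> z = \<tau> z" for z using spans[of z] \<sigma>z \<tau> by auto
    then show ?thesis by blast
  qed
  ultimately have "(THE \<sigma>. \<sigma> \<in> Gal \<iota> \<and> \<sigma> \<noteq> id) = \<tau>"
    by (intro the_equality conjI notI) simp_all
  then show ?thesis unfolding conj_K_def using \<open>\<tau> \<in> Gal \<iota>\<close> \<open>\<tau> s = - s\<close> by simp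
qed

lemma conj_hom: "field_hom conj" and conj_\<iota>: "conj (\<iota> c) = \<iota> c" and conj_s: "conj s = - s"
  using conj_in_Gal by (auto simp: Gal_def)

lemmas conj_simps = field_hom_simps[OF conj_hom] conj_\<iota> conj_s

lemma conj_conj: "conj (conj z) = z"
  using spans[of z] by (auto simp: conj_simps)

lemma conj_fixed: "conj z = z \<Longrightarrow> z \<in> range \<iota>"
proof -
  assume z: "conj z = z"
  obtain a b where ab: "z = \<iota> a + \<iota> b * s" using spans by blast
  have "\<iota> b * s = 0" using z two_neq_0 unfolding ab by (auto simp: conj_simps)
  then show ?thesis using ab by (metis add.right_neutral rangeI)
qed

lemma Im_units_iff: "z \<in> Im_units \<iota> \<longleftrightarrow> (\<exists>e. e \<noteq> 0 \<and> z = \<iota> e * s)"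
proof
  assume "z \<in> Im_units \<iota>"
  then have z: "conj z = - z" "z \<noteq> 0" by (auto simp: Im_units_def)
  have "conj (z / s) = z / s" using z by (simp add: conj_simps)
  then obtain e where "z / s = \<iota> e" using conj_fixed by blast
  then have "z = \<iota> e * s" using s_neq_0 by (simp add: divide_eq_eq)
  then show "\<exists>e. e \<noteq> 0 \<and> z = \<iota> e * s" using z(2) by (auto simp: \<iota>_simps)
next
  assume "\<exists>e. e \<noteq> 0 \<and> z = \<iota> e * s"
  then show "z \<in> Im_units \<iota>" using s_neq_0 by (auto simp: Im_units_def conj_simps \<iota>_simps)
qed

section \<open>Cubics as traces of cubes over the quadratic extension\<close>

definition trace_cube :: "'K \<Rightarrow> 'K ^ 2 \<Rightarrow> 'K poly poly"
  where "trace_cube l p = cube_sum l p (conj l) (map_vec conj p)"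

definition trace_cube_omega :: "'K \<Rightarrow> 'K ^ 2 \<Rightarrow> 'K"
  where "trace_cube_omega l p = l * conj l * br p (map_vec conj p) ^ 3"

lemma map_vec_conj_conj: "map_vec conj (map_vec conj p) = p"
  by (simp add: vec_eq_iff conj_conj)

lemma trace_cube_conj: "trace_cube (conj l) (map_vec conj p) = trace_cube l p"
  by (simp add: trace_cube_def conj_conj map_vec_conj_conj cube_sum_swap)

lemma trace_cube_omega_conj: "trace_cube_omega (conj l) (map_vec conj p) = - trace_cube_omega l p"
  unfolding trace_cube_omega_def map_vec_conj_conj conj_conj br_swap[of "map_vec conj p" p] by algebra

lemma trace_cube_omega_in_Im:
  assumes "trace_cube_omega l p \<noteq> 0"
  shows "trace_cube_omega l p \<in> Im_units \<iota>"
proof -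
  have "conj (trace_cube_omega l p) = trace_cube_omega (conj l) (map_vec conj p)"
    by (simp add: trace_cube_omega_def conj_simps flip: br_map_vec[OF conj_hom])
  then show ?thesis using assms by (simp add: Im_units_def trace_cube_omega_conj)
qed

lemma three_neq_0: "(3::'k) \<noteq> 0 \<Longrightarrow> (3::'K) \<noteq> 0"
  using field_hom_eq_0_iff[OF hom, of 3] by (simp add: field_hom_numeral[OF hom])

lemma base_ext_eq: "base_ext \<iota> = map_coeffs \<iota>"
  by (simp add: base_ext_def map_coeffs_def fun_eq_iff)

lemma conj_form_eq: "conj_form \<iota> = map_coeffs conj"
  by (simp add: conj_form_def map_coeffs_def fun_eq_iff)

lemma Qn_map_coeffs:
  assumes "(3::'k) \<noteq> 0" "P \<in> cubics"
  shows "Qn (map_coeffs \<iota> P) = \<iota> (Qn P)"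
proof -
  obtain a b c d where "P = cubic a b c d" using assms(2) unfolding cubics_def by blast
  then show ?thesis
    by (simp only: map_coeffs_cubic[OF hom] Qn_cubic[OF assms(1)] Qn_cubic[OF three_neq_0[OF assms(1)]] \<iota>_simps)
qed

text \<open>Let \<open>q\<close> be an imaginary square root of the quartic invariant. The coordinates of \<open>P\<close> are fixed by
  conjugation and \<open>q\<close> changes sign, so conjugation exchanges the two summands given by \<open>half_cubic\<close>.\<close>

lemma O_hat_trace_cube:
  assumes ch: "(3::'k) \<noteq> 0" and "P \<in> O_hat \<iota>"
  obtains l p where "map_coeffs \<iota> P = trace_cube l p" "trace_cube_omega l p \<noteq> 0"
proof -
  note chK = two_neq_0 three_neq_0[OF ch]
  have "P \<in> cubics" using assms(2) by (simp add: O_hat_def)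
  then obtain a b c d where P: "P = cubic a b c d" unfolding cubics_def by blast
  obtain q where q: "\<iota> (Qn P) = q ^ 2" "q \<in> Im_units \<iota>"
    using assms(2) unfolding O_hat_def by blast
  have PK: "map_coeffs \<iota> P = cubic (\<iota> a) (\<iota> b) (\<iota> c) (\<iota> d)" by (simp only: P map_coeffs_cubic[OF hom])
  have Q: "Qn (map_coeffs \<iota> P) = q ^ 2" using Qn_map_coeffs[OF ch \<open>P \<in> cubics\<close>] q(1) by simp
  have q': "q \<noteq> 0" "conj q = - q" using q(2) by (auto simp: Im_units_def)
  obtain l p m r where hc: "half_cubic q (\<iota> a) (\<iota> b) (\<iota> c) (\<iota> d) = scale l (lin_form p ^ 3)"
    "half_cubic (- q) (\<iota> a) (\<iota> b) (\<iota> c) (\<iota> d) = scale m (lin_form r ^ 3)"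
    and cs: "cubic (\<iota> a) (\<iota> b) (\<iota> c) (\<iota> d) = cube_sum l p m r"
    using cubic_eq_cube_sum[OF chK Q[unfolded PK] q'(1)] by metis
  have "scale m (lin_form r ^ 3) = map_coeffs conj (half_cubic q (\<iota> a) (\<iota> b) (\<iota> c) (\<iota> d))"
    by (simp only: map_coeffs_half_cubic[OF conj_hom] conj_\<iota> q'(2) hc(2))
  also have "\<dots> = scale (conj l) (lin_form (map_vec conj p) ^ 3)"
    by (simp only: hc(1) map_coeffs_cube[OF conj_hom])
  finally have tc: "map_coeffs \<iota> P = trace_cube l p"
    unfolding PK cs trace_cube_def cube_sum_def by simp
  have "(trace_cube_omega l p) ^ 2 = q ^ 2"
    using Q unfolding tc trace_cube_def Qn_cube_sum[OF chK] trace_cube_omega_def .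
  then have "trace_cube_omega l p \<noteq> 0" using q'(1) by auto
  then show ?thesis using that tc by blast
qed

text \<open>A sum of two conjugate cubes is fixed by conjugation, so its coordinates lie in the ground field.\<close>

lemma trace_cube_descends:
  assumes ch: "(3::'k) \<noteq> 0" and nz: "trace_cube_omega l p \<noteq> 0"
  obtains P where "P \<in> O_hat \<iota>" "map_coeffs \<iota> P = trace_cube l p"
proof -
  note chK = two_neq_0 three_neq_0[OF ch]
  obtain A B C D where tc: "trace_cube l p = cubic A B C D"
    using cube_sum_in_cubics[of l p "conj l" "map_vec conj p"] unfolding cubics_def trace_cube_def by blast
  have "map_coeffs conj (trace_cube l p) = trace_cube l p"
    unfolding trace_cube_def map_coeffs_cube_sum[OF conj_hom] conj_conj map_vec_conj_conj by (rule cube_sum_swap)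
  then have "conj A = A" "conj B = B" "conj C = C" "conj D = D"
    unfolding tc map_coeffs_cubic[OF conj_hom] cubic_inject[OF chK(2)] by auto
  then obtain a b c d where "A = \<iota> a" "B = \<iota> b" "C = \<iota> c" "D = \<iota> d"
    using conj_fixed by (metis imageE)
  then have eq: "map_coeffs \<iota> (cubic a b c d) = trace_cube l p"
    by (simp only: tc map_coeffs_cubic[OF hom])
  have cub: "cubic a b c d \<in> cubics" unfolding cubics_def by blast
  have "\<iota> (Qn (cubic a b c d)) = (trace_cube_omega l p) ^ 2"
    unfolding Qn_map_coeffs[OF ch cub, symmetric] eq unfolding trace_cube_def Qn_cube_sum[OF chK] trace_cube_omega_def ..
  then have "cubic a b c d \<in> O_hat \<iota>"
    using cub trace_cube_omega_in_Im[OF nz] unfolding O_hat_def by blast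
  then show ?thesis using that eq by blast
qed

section \<open>Cube classes of norm one and imaginary units\<close>

lemma conj_class_cube_class: "conj_class \<iota> (cube_class a) = cube_class (conj a)"
proof (intro equalityI subsetI)
  fix z assume "z \<in> conj_class \<iota> (cube_class a)"
  then obtain t where "t \<noteq> 0" "z = conj (t ^ 3 * a)" unfolding conj_class_def cube_class_eq_set by blast
  then have "conj t \<noteq> 0" "z = conj t ^ 3 * conj a" by (simp_all add: conj_simps)
  then show "z \<in> cube_class (conj a)" unfolding cube_class_eq_set by blast
next
  fix z assume "z \<in> cube_class (conj a)"
  then obtain t where "t \<noteq> 0" "z = t ^ 3 * conj a" unfolding cube_class_eq_set by blast
  then have "conj t \<noteq> 0" "z = conj (conj t ^ 3 * a)" by (simp_all add: conj_simps conj_conj)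
  then show "z \<in> conj_class \<iota> (cube_class a)" unfolding conj_class_def cube_class_eq_set by blast
qed

lemma cube_class_in_U_iff:
  assumes "a \<noteq> 0"
  shows "cube_class a \<in> U_classes \<iota> \<longleftrightarrow> cube_class (a * conj a) = cube_class 1"
  using assms cube_class_in_carrier[OF assms]
  by (simp add: U_classes_def conj_class_cube_class cube_class_mult one_cube_classes conj_simps)

text \<open>On classes of norm one, conjugation is inversion. This identifies the involution in the target with
  the one that defines the invariant.\<close>

lemma conj_class_in_U:
  assumes "a \<noteq> 0" "cube_class a \<in> U_classes \<iota>"
  shows "cube_class (conj a) = cube_class (inverse a)" "cube_class (inverse a) \<in> U_classes \<iota>"
proof -
  have ca: "conj a \<noteq> 0" using assms(1) by (simp add: conj_simps)
  obtain t where t: "t \<noteq> 0" "a * conj a = t ^ 3"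
    using assms cube_class_in_U_iff unfolding cube_class_eq_iff by auto
  then have "conj a = t ^ 3 * inverse a" using assms(1) by (simp add: field_simps)
  then show "cube_class (conj a) = cube_class (inverse a)" unfolding cube_class_eq_iff using t(1) by blast
  have "inverse a * conj (inverse a) = (inverse t) ^ 3 * 1"
    using t assms(1) ca by (simp add: conj_simps power_inverse flip: inverse_mult_distrib)
  then have "cube_class (inverse a * conj (inverse a)) = cube_class 1"
    unfolding cube_class_eq_iff using t(1) by (metis nonzero_imp_inverse_nonzero)
  then show "cube_class (inverse a) \<in> U_classes \<iota>"
    using cube_class_in_U_iff[of "inverse a"] assms(1) by simp
qed

lemma ratio_in_U:
  assumes "l \<noteq> 0"
  shows "cube_class (l / conj l) \<in> U_classes \<iota>"
proof -
  have "conj l \<noteq> 0" using assms by (simp add: conj_simps)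
  then have "l / conj l \<noteq> 0" "l / conj l * conj (l / conj l) = 1"
    using assms by (simp_all add: conj_simps conj_conj)
  then show ?thesis using cube_class_in_U_iff by metis
qed

lemma prod_rel_hat_class:
  assumes "x \<in> Im_units \<iota>" "a \<noteq> 0" "cube_class a \<in> U_classes \<iota>"
  shows "prod_rel_hat \<iota> `` {(x, cube_class a)} = {(x, cube_class a), (- x, cube_class (inverse a))}"
proof -
  have "- x \<in> Im_units \<iota>" using assms(1) by (simp add: Im_units_def conj_simps)
  then show ?thesis
    using assms conj_class_in_U[OF assms(2,3)] unfolding prod_rel_hat_def
    by (subst Z2_rel_class) (simp_all add: neg_inv_def cube_class_inv)
qed

lemma conj_rel_class:
  assumes "a \<noteq> 0" "cube_class a \<in> U_classes \<iota>"
  shows "conj_rel \<iota> `` {cube_class a} = {cube_class a, cube_class (inverse a)}"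
  using assms conj_class_in_U[OF assms] unfolding conj_rel_def
  by (subst Z2_rel_class) (simp_all add: conj_class_cube_class)

lemma Im_rel_class_eq_iff:
  assumes "x \<in> Im_units \<iota>" "y \<in> Im_units \<iota>"
  shows "Im_rel \<iota> `` {x} = Im_rel \<iota> `` {y} \<longleftrightarrow> (\<exists>t. t \<noteq> 0 \<and> y = \<iota> t ^ 3 * x)"
proof -
  have rel: "(z, w) \<in> Im_rel \<iota> \<longleftrightarrow> z \<in> Im_units \<iota> \<and> w \<in> Im_units \<iota> \<and> (\<exists>t. t \<noteq> 0 \<and> w = \<iota> t ^ 3 * z)" for z w
    unfolding Im_rel_def cubes_def by (auto simp: \<iota>_simps)
  have "equiv (Im_units \<iota>) (Im_rel \<iota>)"
  proof (rule equivI)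
    show "refl_on (Im_units \<iota>) (Im_rel \<iota>)"
      unfolding refl_on_def rel by (auto intro!: exI[of _ 1] simp: \<iota>_simps)
    show "sym (Im_rel \<iota>)"
    proof (rule symI)
      fix z w assume "(z, w) \<in> Im_rel \<iota>"
      then obtain t where t: "z \<in> Im_units \<iota>" "w \<in> Im_units \<iota>" "t \<noteq> 0" "w = \<iota> t ^ 3 * z" unfolding rel by blast
      then have "z = \<iota> (inverse t) ^ 3 * w" "inverse t \<noteq> 0" by (simp_all add: \<iota>_simps power_inverse)
      then show "(w, z) \<in> Im_rel \<iota>" unfolding rel using t by blast
    qed
    show "trans (Im_rel \<iota>)"
    proof (rule transI)
      fix x y z assume "(x, y) \<in> Im_rel \<iota>" "(y, z) \<in> Im_rel \<iota>"
      then obtain t u where *: "x \<in> Im_units \<iota>" "z \<in> Im_units \<iota>" "t \<noteq> 0" "u \<noteq> 0" "y = \<iota> t ^ 3 * x" "z = \<iota> u ^ 3 * y"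
        unfolding rel by blast
      then have "z = \<iota> (u * t) ^ 3 * x" "u * t \<noteq> 0" by (simp_all add: \<iota>_simps power_mult_distrib)
      then show "(x, z) \<in> Im_rel \<iota>" unfolding rel using * by blast
    qed
  qed (auto simp: Im_rel_def)
  from eq_equiv_class_iff[OF this assms] show ?thesis unfolding rel using assms by blast
qed

lemma Im_rel_class_uminus:
  assumes "x \<in> Im_units \<iota>"
  shows "Im_rel \<iota> `` {- x} = Im_rel \<iota> `` {x}"
proof -
  have m: "- x \<in> Im_units \<iota>" using assms by (simp add: Im_units_def conj_simps)
  have "x = \<iota> (- 1) ^ 3 * (- x)" by (simp add: \<iota>_simps)
  then show ?thesis unfolding Im_rel_class_eq_iff[OF m assms] by (metis neg_equal_0_iff_equal one_neq_zero)
qed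

section \<open>The case of a quadratic extension\<close>

text \<open>As in the split case, the decomposition is unique up to exchanging the two conjugate summands,
  which negates the symplectic product and inverts the norm-one class. Here \<open>l\<close> matters only through
  its cube class: passing from \<open>l\<close> to \<open>t\<^sup>3 l\<close> changes \<open>l / conj l\<close> by the cube of \<open>t / conj t\<close>.\<close>

lemma J_O_hat_trace_cube:
  assumes ch: "(3::'k) \<noteq> 0" and P: "map_coeffs \<iota> P = trace_cube l p" and nz: "trace_cube_omega l p \<noteq> 0"
  shows "J_O_hat \<iota> P = (Im_rel \<iota> `` {trace_cube_omega l p}, {cube_class (l / conj l), cube_class (conj l / l)})"
proof -
  note chK = two_neq_0 three_neq_0[OF ch]
  define N where "N = trace_cube_omega l p"
  define C where "C = {(N, cube_class (l / conj l)), (- N, cube_class (conj l / l))}"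
  define val where "val \<mu> \<alpha> = prod_rel_hat \<iota> `` {(omega (scale \<mu> (\<alpha> ^ 3)) (scale (conj \<mu>) (conj_form \<iota> \<alpha> ^ 3)),
                        cube_class (\<mu> * inverse (conj \<mu>)))}" for \<mu> and \<alpha> :: "'K poly poly"
  define admissible where "admissible \<mu> \<alpha> \<longleftrightarrow> \<mu> \<noteq> 0 \<and> \<alpha> \<in> range lin_form \<and> lin_indep_pair \<alpha> (conj_form \<iota> \<alpha>) \<and>
       base_ext \<iota> P = scale \<mu> (\<alpha> ^ 3) + scale (conj \<mu>) (conj_form \<iota> \<alpha> ^ 3)" for \<mu> and \<alpha> :: "'K poly poly"
  have adm: "admissible \<mu> (lin_form r) \<longleftrightarrow> trace_cube_omega \<mu> r \<noteq> 0 \<and> trace_cube l p = trace_cube \<mu> r" for \<mu> r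
    unfolding admissible_def base_ext_eq conj_form_eq map_coeffs_lin_form[OF conj_hom] lin_indep_pair_iff P
    by (auto simp: trace_cube_omega_def trace_cube_def cube_sum_def conj_simps)
  have vl: "val \<mu> (lin_form r) = {(trace_cube_omega \<mu> r, cube_class (\<mu> / conj \<mu>)), (- trace_cube_omega \<mu> r, cube_class (conj \<mu> / \<mu>))}"
    if t: "trace_cube_omega \<mu> r \<noteq> 0" for \<mu> r
  proof -
    have "\<mu> \<noteq> 0" "conj \<mu> \<noteq> 0" using t by (auto simp: trace_cube_omega_def)
    then have "\<mu> / conj \<mu> \<noteq> 0" "inverse (\<mu> / conj \<mu>) = conj \<mu> / \<mu>" by simp_all
    then show ?thesis
      unfolding val_def conj_form_eq map_coeffs_lin_form[OF conj_hom] omega_cubes[OF chK(2)]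
        trace_cube_omega_def[symmetric] divide_inverse[symmetric]
      using prod_rel_hat_class[OF trace_cube_omega_in_Im[OF t] _ ratio_in_U[OF \<open>\<mu> \<noteq> 0\<close>]] by simp
  qed
  have l: "l \<noteq> 0" "conj l \<noteq> 0" "p \<noteq> 0" "map_vec conj p \<noteq> 0"
    using nz nonzero_if_br_neq_0[of p "map_vec conj p"] by (auto simp: trace_cube_omega_def)
  have "val \<mu> \<alpha> = C" if a: "admissible \<mu> \<alpha>" for \<mu> \<alpha>
  proof -
    obtain r where r: "\<alpha> = lin_form r" using a unfolding admissible_def by blast
    have t: "trace_cube_omega \<mu> r \<noteq> 0" and eq: "trace_cube l p = trace_cube \<mu> r"
      using a unfolding r adm by auto
    have m: "\<mu> \<noteq> 0" "conj \<mu> \<noteq> 0" "r \<noteq> 0" "map_vec conj r \<noteq> 0"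
      using t nonzero_if_br_neq_0[of r "map_vec conj r"] by (auto simp: trace_cube_omega_def)
    have conj_cl: "cube_class (conj x) = cube_class (conj y)" if "cube_class x = cube_class y" for x y
      using that conj_class_cube_class by metis
    have div_cl: "cube_class (x / y) = cube_class (x' / y')"
      if "cube_class x = cube_class x'" "cube_class y = cube_class y'" "x \<noteq> 0" "y \<noteq> 0" "x' \<noteq> 0" "y' \<noteq> 0" for x y x' y' :: 'K
      using that cube_class_mult[of x "inverse y"] cube_class_mult[of x' "inverse y'"]
        cube_class_inv[of y] cube_class_inv[of y'] by (simp add: divide_inverse)
    note IT = I_T_cube[OF chK(2)]
    have "trace_cube_omega \<mu> r = N \<and> cube_class \<mu> = cube_class l
       \<or> trace_cube_omega \<mu> r = - N \<and> cube_class \<mu> = cube_class (conj l)"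
      using cube_sum_unique[OF chK eq[unfolded trace_cube_def] trace_cube_omega_def nz trace_cube_omega_def t]
        IT[OF l(1,3)] IT[OF l(2,4)] IT[OF m(1,3)] unfolding N_def by metis
    then show ?thesis
    proof
      assume *: "trace_cube_omega \<mu> r = N \<and> cube_class \<mu> = cube_class l"
      then have "cube_class (conj \<mu>) = cube_class (conj l)" using conj_cl by blast
      then have "cube_class (\<mu> / conj \<mu>) = cube_class (l / conj l)" "cube_class (conj \<mu> / \<mu>) = cube_class (conj l / l)"
        using * l m div_cl[of \<mu> l "conj \<mu>" "conj l"] div_cl[of "conj \<mu>" "conj l" \<mu> l] by simp_all
      then show ?thesis unfolding r vl[OF t] C_def using * by simp
    next
      assume *: "trace_cube_omega \<mu> r = - N \<and> cube_class \<mu> = cube_class (conj l)"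
      then have "cube_class (conj \<mu>) = cube_class l" using conj_cl[of \<mu> "conj l"] by (simp add: conj_conj)
      then have "cube_class (\<mu> / conj \<mu>) = cube_class (conj l / l)" "cube_class (conj \<mu> / \<mu>) = cube_class (l / conj l)"
        using * l m div_cl[of \<mu> "conj l" "conj \<mu>" l] div_cl[of "conj \<mu>" l \<mu> "conj l"] by simp_all
      then show ?thesis unfolding r vl[OF t] C_def using * by (simp add: insert_commute)
    qed
  qed
  moreover have "admissible l (lin_form p)" unfolding adm using nz by simp
  ultimately have "{val \<mu> \<alpha> | \<mu> \<alpha>. admissible \<mu> \<alpha>} = {C}" by blast
  then have "I_O_hat \<iota> P = C" unfolding I_O_hat_def val_def admissible_def by simp
  moreover have "N \<in> Im_units \<iota>" unfolding N_def by (rule trace_cube_omega_in_Im[OF nz])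
  then have "Im_rel \<iota> `` {- N} = Im_rel \<iota> `` {N}" by (rule Im_rel_class_uminus)
  moreover have "conj_rel \<iota> `` {cube_class (l / conj l)} = {cube_class (l / conj l), cube_class (conj l / l)}"
    using conj_rel_class[of "l / conj l"] ratio_in_U[OF l(1)] l by simp
  moreover have "conj_rel \<iota> `` {cube_class (conj l / l)} = {cube_class (l / conj l), cube_class (conj l / l)}"
    using conj_rel_class[of "conj l / l"] ratio_in_U[OF l(2)] l by (simp add: conj_conj insert_commute)
  ultimately show ?thesis
    by (simp add: J_O_hat_def proj_pi_hat_def C_def flip: N_def)
qed

text \<open>The coordinates of \<open>p\<close> with respect to the basis \<open>1, s\<close>. The last equation shows that \<open>p\<close> and its
  conjugate are independent exactly when the two coordinate vectors are independent over the ground field.\<close>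

lemma vec_coords:
  fixes p :: "'K^2"
  obtains u w where "p = map_vec \<iota> u + s *s map_vec \<iota> w" "map_vec conj p = map_vec \<iota> u - s *s map_vec \<iota> w"
    "br p (map_vec conj p) = - 2 * s * \<iota> (br u w)"
proof -
  obtain a b c d where ab: "p $ 1 = \<iota> a + \<iota> b * s" and cd: "p $ 2 = \<iota> c + \<iota> d * s" using spans by metis
  define u w :: "'k^2" where "u = vector [a, c]" and "w = vector [b, d]"
  have p: "p = map_vec \<iota> u + s *s map_vec \<iota> w" "map_vec conj p = map_vec \<iota> u - s *s map_vec \<iota> w"
    by (simp_all add: vec_eq_iff forall_2 ab cd u_def w_def conj_simps)
  moreover have "br p (map_vec conj p) = - 2 * s * \<iota> (br u w)"
    unfolding p(2) br_map_vec[OF hom, symmetric] unfolding p(1) br_def by (simp add: algebra_simps)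
  ultimately show ?thesis by (rule that)
qed

text \<open>A matrix over the ground field that carries the coordinate vectors of \<open>p\<close> to those of \<open>r\<close> also carries
  \<open>p\<close> to \<open>r\<close>, and commutes with conjugation.\<close>

lemma descended_transitivity:
  fixes p r :: "'K^2"
  assumes "br p (map_vec conj p) \<noteq> 0" "br r (map_vec conj r) \<noteq> 0"
  obtains M where "invertible M" "p v* map_vec (map_vec \<iota>) M = r"
    "map_vec conj p v* map_vec (map_vec \<iota>) M = map_vec conj r"
proof -
  obtain u w where p: "p = map_vec \<iota> u + s *s map_vec \<iota> w" "map_vec conj p = map_vec \<iota> u - s *s map_vec \<iota> w"
    and "br p (map_vec conj p) = - 2 * s * \<iota> (br u w)" using vec_coords .
  then have uw: "br u w \<noteq> 0" using assms(1) by (auto simp: \<iota>_simps)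
  obtain u' w' where r: "r = map_vec \<iota> u' + s *s map_vec \<iota> w'" "map_vec conj r = map_vec \<iota> u' - s *s map_vec \<iota> w'"
    and "br r (map_vec conj r) = - 2 * s * \<iota> (br u' w')" using vec_coords .
  then have uw': "br u' w' \<noteq> 0" using assms(2) by (auto simp: \<iota>_simps)
  obtain M where M: "invertible M" "u v* M = u'" "w v* M = w'" using br_transitive[OF uw uw'] .
  let ?M = "map_vec (map_vec \<iota>) M"
  have "map_vec \<iota> u v* ?M = map_vec \<iota> u'" "map_vec \<iota> w v* ?M = map_vec \<iota> w'"
    by (simp_all add: M(2,3) flip: map_vec_vector_matrix_mult[OF hom])
  moreover have "(x + s *s y) v* ?M = x v* ?M + s *s (y v* ?M)" "(x - s *s y) v* ?M = x v* ?M - s *s (y v* ?M)" for x y :: "'K^2"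
    by (simp_all add: vec_eq_iff vector_matrix_mult_def sum_2 algebra_simps)
  ultimately have "p v* ?M = r" "map_vec conj p v* ?M = map_vec conj r"
    unfolding p(2) r(2) unfolding p(1) r(1) by simp_all
  then show ?thesis by (rule that[OF M(1)])
qed

lemma conj_vector_matrix_mult:
  "map_vec conj (p v* map_vec (map_vec \<iota>) (M :: 'k^2^2)) = map_vec conj p v* map_vec (map_vec \<iota>) M"
  by (simp add: vec_eq_iff vector_matrix_mult_def sum_2 conj_simps)

lemma lin_subst_trace_cube:
  fixes M :: "'k^2^2"
  shows "lin_subst (map_vec (map_vec \<iota>) M) (trace_cube l p) = trace_cube l (p v* map_vec (map_vec \<iota>) M)"
  by (simp add: trace_cube_def lin_subst_cube_sum conj_vector_matrix_mult)

lemma trace_cube_omega_lin_subst: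
  fixes M :: "'k^2^2"
  shows "trace_cube_omega l (p v* map_vec (map_vec \<iota>) M) = \<iota> (det M) ^ 3 * trace_cube_omega l p"
  by (simp add: trace_cube_omega_def conj_vector_matrix_mult br_vector_matrix_mult det_map_vec[OF hom] power_mult_distrib)

lemma cube_class_trace_cube_omega:
  assumes "trace_cube_omega l p \<noteq> 0"
  shows "cube_class (trace_cube_omega l p) = cube_class (l * conj l)"
  using assms unfolding trace_cube_omega_def by (auto intro!: cube_class_times_cube)

text \<open>Over the extension the two classes determine \<open>l\<close> up to a cube, which is absorbed into the linear
  form; the conjugate summand follows automatically. Then a matrix over the ground field carries
  one linear form to the other.\<close>

lemma orbit_eq_if_invariants_eq:
  assumes P: "map_coeffs \<iota> P = trace_cube l p" "trace_cube_omega l p \<noteq> 0"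
    and P': "map_coeffs \<iota> P' = trace_cube l' p'" "trace_cube_omega l' p' \<noteq> 0"
    and om: "Im_rel \<iota> `` {trace_cube_omega l p} = Im_rel \<iota> `` {trace_cube_omega l' p'}"
    and cl: "cube_class (l / conj l) = cube_class (l' / conj l')"
  shows "orbit GL2 act P = orbit GL2 act P'"
proof -
  have l: "l \<noteq> 0" "conj l \<noteq> 0" "br p (map_vec conj p) \<noteq> 0" using P(2) by (auto simp: trace_cube_omega_def)
  have l': "l' \<noteq> 0" "conj l' \<noteq> 0" "br p' (map_vec conj p') \<noteq> 0" using P'(2) by (auto simp: trace_cube_omega_def)
  obtain t where t: "t \<noteq> 0" "trace_cube_omega l' p' = \<iota> t ^ 3 * trace_cube_omega l p"
    using om unfolding Im_rel_class_eq_iff[OF trace_cube_omega_in_Im[OF P(2)] trace_cube_omega_in_Im[OF P'(2)]] by blast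
  then have "cube_class (trace_cube_omega l' p') = cube_class (trace_cube_omega l p)"
    unfolding cube_class_eq_iff by (metis field_hom_eq_0_iff[OF hom])
  then have prod: "cube_class (l * conj l) = cube_class (l' * conj l')"
    by (simp add: cube_class_trace_cube_omega P(2) P'(2))
  obtain v where v: "v \<noteq> 0" "l = v ^ 3 * l'" using ratio_is_cube[OF l(1,2) l'(1,2) prod cl] .
  have cv: "conj v \<noteq> 0" "conj l = conj v ^ 3 * conj l'" using v by (simp_all add: conj_simps)
  have mv: "map_vec conj (v *s p) = conj v *s map_vec conj p" by (simp add: vec_eq_iff conj_simps)
  have tc: "trace_cube l p = trace_cube l' (v *s p)"
    unfolding trace_cube_def cube_sum_def mv by (simp only: v(2) cv(2) scale_cube_smult conj_simps)
  have "br (v *s p) (map_vec conj (v *s p)) \<noteq> 0" using l(3) v(1) cv(1) by (simp add: mv br_smult)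
  then obtain M where M: "invertible M" "(v *s p) v* map_vec (map_vec \<iota>) M = p'"
    using descended_transitivity[OF _ l'(3)] by blast
  have "map_coeffs \<iota> (lin_subst M P) = map_coeffs \<iota> P'"
    by (simp only: map_coeffs_lin_subst[OF hom] P(1) P'(1) tc lin_subst_trace_cube M(2))
  then have "P' = lin_subst M P" by (simp add: map_coeffs_inject[OF hom])
  then show ?thesis unfolding orbit_eq_iff using M(1) by blast
qed

text \<open>A substitution multiplies the symplectic product of the summands by the cube of its determinant,
  which lies in the ground field and so does not affect the class. In the converse direction, inverting
  the norm-one class corresponds to exchanging \<open>l \<phi>\<^sup>3\<close> with its conjugate.\<close>

lemma J_O_hat_separates_orbits:
  assumes ch: "(3::'k) \<noteq> 0" and "P \<in> O_hat \<iota>" "P' \<in> O_hat \<iota>"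
  shows "orbit GL2 act P = orbit GL2 act P' \<longleftrightarrow> J_O_hat \<iota> P = J_O_hat \<iota> P'"
proof -
  obtain l p where P: "map_coeffs \<iota> P = trace_cube l p" "trace_cube_omega l p \<noteq> 0"
    using O_hat_trace_cube[OF ch assms(2)] .
  obtain l' p' where P': "map_coeffs \<iota> P' = trace_cube l' p'" "trace_cube_omega l' p' \<noteq> 0"
    using O_hat_trace_cube[OF ch assms(3)] .
  show ?thesis
  proof
    assume "orbit GL2 act P = orbit GL2 act P'"
    then obtain M where M: "invertible M" "P' = lin_subst M P" by (auto simp: orbit_eq_iff)
    let ?p = "p v* map_vec (map_vec \<iota>) M"
    have d: "det M \<noteq> 0" using M(1) by (simp add: invertible_det_nz)
    have tc: "map_coeffs \<iota> P' = trace_cube l ?p"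
      by (simp only: M(2) map_coeffs_lin_subst[OF hom] P(1) lin_subst_trace_cube)
    have nz: "trace_cube_omega l ?p \<noteq> 0"
      using P(2) d by (simp add: trace_cube_omega_lin_subst \<iota>_simps)
    have "Im_rel \<iota> `` {trace_cube_omega l p} = Im_rel \<iota> `` {trace_cube_omega l ?p}"
      unfolding Im_rel_class_eq_iff[OF trace_cube_omega_in_Im[OF P(2)] trace_cube_omega_in_Im[OF nz]]
      using d trace_cube_omega_lin_subst by blast
    then show "J_O_hat \<iota> P = J_O_hat \<iota> P'"
      by (simp only: J_O_hat_trace_cube[OF ch P] J_O_hat_trace_cube[OF ch tc nz])
  next
    assume "J_O_hat \<iota> P = J_O_hat \<iota> P'"
    then have om: "Im_rel \<iota> `` {trace_cube_omega l p} = Im_rel \<iota> `` {trace_cube_omega l' p'}"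
      and alt: "cube_class (l / conj l) = cube_class (l' / conj l') \<or> cube_class (l / conj l) = cube_class (conj l' / l')"
      unfolding J_O_hat_trace_cube[OF ch P] J_O_hat_trace_cube[OF ch P'] by (auto simp: doubleton_eq_iff)
    from alt show "orbit GL2 act P = orbit GL2 act P'"
    proof
      assume "cube_class (l / conj l) = cube_class (l' / conj l')"
      then show ?thesis by (rule orbit_eq_if_invariants_eq[OF P P' om])
    next
      assume "cube_class (l / conj l) = cube_class (conj l' / l')"
      then have cl: "cube_class (l / conj l) = cube_class (conj l' / conj (conj l'))" by (simp add: conj_conj)
      have tc: "map_coeffs \<iota> P' = trace_cube (conj l') (map_vec conj p')" by (simp add: P'(1) trace_cube_conj)
      have nz: "trace_cube_omega (conj l') (map_vec conj p') \<noteq> 0" using P'(2) by (simp add: trace_cube_omega_conj)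
      have "Im_rel \<iota> `` {trace_cube_omega l p} = Im_rel \<iota> `` {trace_cube_omega (conj l') (map_vec conj p')}"
        by (simp add: om trace_cube_omega_conj Im_rel_class_uminus trace_cube_omega_in_Im P'(2))
      then show ?thesis using cl by (rule orbit_eq_if_invariants_eq[OF P tc nz])
    qed
  qed
qed

text \<open>Let \<open>n = t\<^sup>3\<close> be the norm of \<open>\<beta>\<close> and \<open>\<tau>\<close> the norm of \<open>t\<close>. Taking norms gives \<open>n\<^sup>2 = \<tau>\<^sup>3\<close>, so
  \<open>n = n\<^sup>3 / n\<^sup>2\<close> is the cube of \<open>n / \<tau>\<close>, an element of the ground field.\<close>

lemma norm_cube_descends:
  assumes "\<beta> \<noteq> 0" "cube_class \<beta> \<in> U_classes \<iota>"
  obtains c where "c \<noteq> 0" "\<beta> * conj \<beta> = \<iota> c ^ 3"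
proof -
  have "\<exists>t. t \<noteq> 0 \<and> \<beta> * conj \<beta> = t ^ 3"
    using assms cube_class_in_U_iff unfolding cube_class_eq_iff by auto
  then obtain t where t: "t \<noteq> 0" "\<beta> * conj \<beta> = t ^ 3" by blast
  have "conj (\<beta> * conj \<beta>) = \<beta> * conj \<beta>" "conj (t * conj t) = t * conj t" by (simp_all add: conj_simps conj_conj)
  then obtain n \<tau> where n: "\<beta> * conj \<beta> = \<iota> n" and \<tau>: "t * conj t = \<iota> \<tau>" using conj_fixed by (metis imageE)
  have "conj (t ^ 3) = t ^ 3" using t(2) \<open>conj (\<beta> * conj \<beta>) = \<beta> * conj \<beta>\<close> by simp
  then have "t ^ 3 * t ^ 3 = (t * conj t) ^ 3" by (simp add: power_mult_distrib conj_simps)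
  then have "\<iota> (n ^ 2) = \<iota> (\<tau> ^ 3)"
    using t(2) n by (simp add: \<tau> \<iota>_simps power2_eq_square)
  then have sq: "n ^ 2 = \<tau> ^ 3" using injD[OF field_hom_inj[OF hom]] by blast
  have "\<iota> n \<noteq> 0" "\<iota> \<tau> \<noteq> 0" unfolding n[symmetric] \<tau>[symmetric] using assms(1) t(1) by (simp_all add: conj_simps)
  then have nz: "n \<noteq> 0" "\<tau> \<noteq> 0" by (auto simp: \<iota>_simps)
  have "n = (n / \<tau>) ^ 3" using nz sq by (simp add: power_divide eq_divide_eq flip: sq) (simp add: power2_eq_square power3_eq_cube)
  then have "\<beta> * conj \<beta> = \<iota> (n / \<tau>) ^ 3" using n by (metis field_hom_power[OF hom])
  then show ?thesis using that[of "n / \<tau>"] nz by simp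
qed

lemma J_O_hat_image:
  assumes ch: "(3::'k) \<noteq> 0"
  shows "J_O_hat \<iota> ` O_hat \<iota> = J_hat_target \<iota>"
proof (intro equalityI subsetI)
  fix z assume "z \<in> J_O_hat \<iota> ` O_hat \<iota>"
  then obtain P where "P \<in> O_hat \<iota>" and z: "z = J_O_hat \<iota> P" by blast
  then obtain l p where P: "map_coeffs \<iota> P = trace_cube l p" "trace_cube_omega l p \<noteq> 0"
    using O_hat_trace_cube[OF ch] by metis
  have l: "l \<noteq> 0" "conj l \<noteq> 0" using P(2) by (auto simp: trace_cube_omega_def)
  have "z = (Im_rel \<iota> `` {trace_cube_omega l p}, conj_rel \<iota> `` {cube_class (l / conj l)})"
    using conj_rel_class[of "l / conj l"] l ratio_in_U[OF l(1)] by (simp add: z J_O_hat_trace_cube[OF ch P])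
  then show "z \<in> J_hat_target \<iota>"
    using trace_cube_omega_in_Im[OF P(2)] ratio_in_U[OF l(1)] by (simp add: J_hat_target_def quotientI)
next
  fix z assume "z \<in> J_hat_target \<iota>"
  then obtain x \<alpha> where x: "x \<in> Im_units \<iota>" and \<alpha>: "\<alpha> \<in> U_classes \<iota>" and z: "z = (Im_rel \<iota> `` {x}, conj_rel \<iota> `` {\<alpha>})"
    by (auto simp: J_hat_target_def quotient_def)
  obtain \<beta> where \<beta>: "\<beta> \<noteq> 0" "\<alpha> = cube_class \<beta>" using \<alpha> by (auto simp: U_classes_def carrier_cube_classes)
  have c\<beta>: "conj \<beta> \<noteq> 0" using \<beta>(1) by (simp add: conj_simps)
  obtain c where c: "c \<noteq> 0" "\<beta> * conj \<beta> = \<iota> c ^ 3" using norm_cube_descends \<beta> \<alpha> by blast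
  obtain e where e: "e \<noteq> 0" "x = \<iota> e * s" using x Im_units_iff by blast
  have "\<iota> \<delta> \<noteq> 0" using s_sq s_neq_0 by (metis power_not_zero)
  then have \<delta>: "\<delta> \<noteq> 0" by (auto simp: \<iota>_simps)
  \<comment> \<open>Division by \<open>\<beta>\<close> gives \<open>l / conj l = conj \<beta> / \<beta>\<close>, which has the class of \<open>\<beta>\<^sup>-\<^sup>2\<close> and hence of \<open>\<beta>\<close>. A
    factor \<open>r\<close> from the ground field does not affect this, and the symplectic product is \<open>r\<^sup>2 \<delta> s\<close> up to
    cubes of the ground field; so \<open>r = \<delta> / e\<close> produces the class of \<open>e s\<close>.\<close>
  define l where "l = \<iota> (\<delta> / e) / \<beta>"
  define p :: "'K^2" where "p = vector [1, s]"
  have cl: "conj l = \<iota> (\<delta> / e) / conj \<beta>" by (simp add: l_def conj_simps del: field_hom_divide[OF hom])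
  have brp: "br p (map_vec conj p) = - 2 * s" by (simp add: br_def p_def conj_simps)
  have "trace_cube_omega l p = \<iota> (\<delta> / e) ^ 2 / \<iota> c ^ 3 * (- 2 * s) ^ 3"
    unfolding trace_cube_omega_def brp cl c(2)[symmetric] by (simp add: l_def power2_eq_square)
  also have "\<dots> = \<iota> (- 2 * \<delta> / (e * c)) ^ 3 * x"
  proof -
    have "(- 2 * s) ^ 3 = \<iota> (- 8 * \<delta>) * s" using s_sq by (simp add: \<iota>_simps power2_eq_square power3_eq_cube flip: s_sq)
    moreover have "(\<delta> / e) ^ 2 / c ^ 3 * (- 8 * \<delta>) = (- 2 * \<delta> / (e * c)) ^ 3 * e"
      using e(1) c(1) by (simp add: power_divide power_mult_distrib power2_eq_square power3_eq_cube mult_ac)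
    ultimately show ?thesis unfolding e(2) by (metis field_hom_divide[OF hom] field_hom_mult[OF hom] field_hom_power[OF hom] mult.assoc)
  qed
  finally have om: "trace_cube_omega l p = \<iota> (- 2 * \<delta> / (e * c)) ^ 3 * x" .
  have t: "- 2 * \<delta> / (e * c) \<noteq> 0" using char2 \<delta> e(1) c(1) by simp
  have "x \<noteq> 0" using x by (simp add: Im_units_def)
  then have nz: "trace_cube_omega l p \<noteq> 0" unfolding om using t by (simp add: field_hom_eq_0_iff[OF hom])
  have Im: "Im_rel \<iota> `` {x} = Im_rel \<iota> `` {trace_cube_omega l p}"
    unfolding Im_rel_class_eq_iff[OF x trace_cube_omega_in_Im[OF nz]] using om t by blast
  have l0: "l \<noteq> 0" "conj l \<noteq> 0" using nz by (auto simp: trace_cube_omega_def)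
  have "l / conj l = conj \<beta> / \<beta>" 
    unfolding cl using \<delta> e(1) \<beta>(1) c\<beta> by (simp add: l_def field_hom_eq_0_iff[OF hom])
  also have "\<dots> = (\<iota> c / \<beta>) ^ 3 * \<beta>" 
    unfolding power_divide c(2)[symmetric] using \<beta>(1) by (simp add: power3_eq_cube)
  finally have "cube_class (l / conj l) = cube_class \<beta>"
    unfolding cube_class_eq_iff using c(1) \<beta>(1) by (metis divide_eq_0_iff field_hom_eq_0_iff[OF hom])
  then have "conj_rel \<iota> `` {\<alpha>} = {cube_class (l / conj l), cube_class (conj l / l)}"
    unfolding \<beta>(2) using conj_rel_class[of "l / conj l"] ratio_in_U[OF l0(1)] l0 by simp
  moreover obtain P where "P \<in> O_hat \<iota>" "map_coeffs \<iota> P = trace_cube l p"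
    using trace_cube_descends[OF ch nz] .
  ultimately have "z = J_O_hat \<iota> P" unfolding z Im using J_O_hat_trace_cube[OF ch _ nz] by simp
  then show "z \<in> J_O_hat \<iota> ` O_hat \<iota>" using \<open>P \<in> O_hat \<iota>\<close> by blast
qed

end

section \<open>Classification of the orbits\<close>

text \<open>A complete invariant factors through the orbit set, with the factor evaluated on a chosen representative.\<close>

lemma complete_invariant_bij_betw_orbits:
  assumes sep: "\<And>P P'. P \<in> X \<Longrightarrow> P' \<in> X \<Longrightarrow> orbit G \<phi> P = orbit G \<phi> P' \<longleftrightarrow> J P = J P'"
    and im: "J ` X = Y"
  shows "\<exists>F. (\<forall>P\<in>X. F (orbit G \<phi> P) = J P) \<and> bij_betw F (orbits G X \<phi>) Y"
proof -
  define F where "F B = J (SOME P. P \<in> X \<and> orbit G \<phi> P = B)" for B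
  have F: "F (orbit G \<phi> P) = J P" if "P \<in> X" for P
  proof -
    have "\<exists>P'. P' \<in> X \<and> orbit G \<phi> P' = orbit G \<phi> P" using that by blast
    from someI_ex[OF this] show ?thesis unfolding F_def using sep that by blast
  qed
  have orbits: "orbits G X \<phi> = orbit G \<phi> ` X" by (auto simp: orbits_def)
  have "inj_on F (orbits G X \<phi>)"
    unfolding orbits by (intro inj_onI, elim imageE) (metis F sep)
  moreover have "F ` orbits G X \<phi> = Y"
    unfolding orbits image_image im[symmetric] using F by (rule image_cong[OF refl])
  ultimately show ?thesis using F unfolding bij_betw_def by blast
qed

theorem theorem4p3:
  assumes "(2 :: 'k::field) \<noteq> 0" and "(3 :: 'k) \<noteq> 0"
  shows
    "(\<forall>P \<in> (O1 :: 'k poly poly set). \<forall>P' \<in> O1.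
        orbit GL2 act P = orbit GL2 act P' \<longleftrightarrow> J_O1 P = J_O1 P')
   \<and> (\<exists>F. (\<forall>P \<in> (O1 :: 'k poly poly set). F (orbit GL2 act P) = J_O1 P)
        \<and> bij_betw F (orbits GL2 O1 act) J_target)
   \<and> (\<forall>\<iota> :: 'k \<Rightarrow> 'K::field. quadratic_extension \<iota> \<longrightarrow>
        (\<forall>P \<in> O_hat \<iota>. \<forall>P' \<in> O_hat \<iota>.
           orbit GL2 act P = orbit GL2 act P' \<longleftrightarrow> J_O_hat \<iota> P = J_O_hat \<iota> P')
      \<and> (\<exists>F. (\<forall>P \<in> O_hat \<iota>. F (orbit GL2 act P) = J_O_hat \<iota> P)
           \<and> bij_betw F (orbits GL2 (O_hat \<iota>) act) (J_hat_target \<iota>)))"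
proof (intro conjI allI impI ballI)
  show "orbit GL2 act P = orbit GL2 act P' \<longleftrightarrow> J_O1 P = J_O1 P'"
    if "P \<in> O1" "P' \<in> O1" for P P' :: "'k poly poly"
    using that by (rule J_O1_separates_orbits[OF assms])
  show "\<exists>F. (\<forall>P \<in> (O1 :: 'k poly poly set). F (orbit GL2 act P) = J_O1 P)
        \<and> bij_betw F (orbits GL2 O1 act) J_target"
    by (rule complete_invariant_bij_betw_orbits[OF J_O1_separates_orbits[OF assms] J_O1_image[OF assms]])
next
  fix \<iota> :: "'k \<Rightarrow> 'K" assume "quadratic_extension \<iota>"
  then obtain s \<delta> where "quadratic_generator \<iota> s \<delta>" using quadratic_extension_generator assms(1) by blast
  then interpret quadratic_generator \<iota> s \<delta> .
  show "orbit GL2 act P = orbit GL2 act P' \<longleftrightarrow> J_O_hat \<iota> P = J_O_hat \<iota> P'"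
    if "P \<in> O_hat \<iota>" "P' \<in> O_hat \<iota>" for P P'
    using that by (rule J_O_hat_separates_orbits[OF assms(2)])
  show "\<exists>F. (\<forall>P \<in> O_hat \<iota>. F (orbit GL2 act P) = J_O_hat \<iota> P)
           \<and> bij_betw F (orbits GL2 (O_hat \<iota>) act) (J_hat_target \<iota>)"
    by (rule complete_invariant_bij_betw_orbits[OF J_O_hat_separates_orbits[OF assms(2)] J_O_hat_image[OF assms(2)]])
qed

end
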